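(* Let $1<p<2$ and let $\{X_n,\ n\geqslant 1\}$ be a sequence of widely orthant dependent random variables with dominating sequence $\{M_n,\ n\geqslant 1\}$ satisfying $M_n=O(n^{\alpha})$, $n\to\infty$, for some $\alpha>0$, and stochastically dominated by a random variable $X$ with $\mathbb{E}|X|^{p}<\infty$. Let $\{c_{n,k},\ 1\leqslant k\leqslant n,\ n\geqslant 1\}$ be an array of (real) constants such that $$\max_{1\leqslant k\leqslant n}|c_{n,k}|=O(1),\quad n\to\infty.$$ Then $$\frac{1}{n^{1/p}\,(\operatorname{Log} n)^{1-1/p}}\sum_{k=1}^{n}c_{n,k}(X_k-\mathbb{E}X_k)\to 0\quad\text{almost surely as } n\to\infty.$$
   Context: All random variables are real-valued and defined on a common probability space $(\Omega,\mathcal F,\mathbb P)$. $\operatorname{Log} x$ denotes $\log\max\{x,e\}$ (natural logarithm). A sequence $\{X_n,\ n\geqslant 1\}$ is widely orthant dependent with dominating sequence $\{M_n,\ n\geqslant 1\}$ if, for each $n\geqslant 1$, $M_n$ is a finite positive number such that both $$\mathbb{P}\left(\bigcap_{k=1}^{n}\{X_k>x_k\}\right)\leqslant M_n\prod_{k=1}^{n}\mathbb{P}\{X_k>x_k\}$$ and $$\mathbb{P}\left(\bigcap_{k=1}^{n}\{X_k\leqslant x_k\}\right)\leqslant M_n\prod_{k=1}^{n}\mathbb{P}\{X_k\leqslant x_k\}$$ hold for all real numbers $x_1,\ldots,x_n$. The sequence is stochastically dominated by a random variable $X$ if there is a constant $C>0$ such that $\mathbb{P}\{|X_n|>t\}\leqslant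 C\,\mathbb{P}\{|X|>t\}$ for all $t>0$ and every $n\geqslant 1$. *)

theory Defs
  imports "HOL-Probability.Probability" "HOL-Library.Landau_Symbols"
begin

definition Log :: "real \<Rightarrow> real" where
  "Log x = ln (max x (exp 1))"

text \<open>Sequences are indexed by the positive integers: the values at index \<open>0\<close> are
  never used.  Measurability is not part of the following two notions; it has to be assumed
  separately.\<close>

definition widely_orthant_dependent ::
    "'a measure \<Rightarrow> (nat \<Rightarrow> 'a \<Rightarrow> real) \<Rightarrow> (nat \<Rightarrow> real) \<Rightarrow> bool" where
  "widely_orthant_dependent P X M \<longleftrightarrow>
    (\<forall>n\<ge>1. M n > 0 \<and>
      (\<forall>x :: nat \<Rightarrow> real.
        \<P>(\<omega> in P. \<forall>k\<in>{1..n}. X k \<omega> > x k) \<le> M n * (\<Prod>k=1..n. \<P>(\<omega> in P. X k \<omega> > x k)) \<and>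
        \<P>(\<omega> in P. \<forall>k\<in>{1..n}. X k \<omega> \<le> x k) \<le> M n * (\<Prod>k=1..n. \<P>(\<omega> in P. X k \<omega> \<le> x k))))"

definition stochastically_dominated ::
    "'a measure \<Rightarrow> (nat \<Rightarrow> 'a \<Rightarrow> real) \<Rightarrow> ('a \<Rightarrow> real) \<Rightarrow> bool" where
  "stochastically_dominated P X Y \<longleftrightarrow>
    (\<exists>C>0. \<forall>n\<ge>1. \<forall>t>0. \<P>(\<omega> in P. \<bar>X n \<omega>\<bar> > t) \<le> C * \<P>(\<omega> in P. \<bar>Y \<omega>\<bar> > t))"

end

theory Submission
  imports Defs "HOL-Real_Asymp.Real_Asymp"
begin

text \<open>Put \<open>a\<^sub>n = (n / Log n)\<^bsup>1/p\<^esup>\<close>. The normalizer is then \<open>b\<^sub>n = a\<^sub>n Log n\<close>, and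
\<open>n / b\<^sub>n = a\<^sub>n\<^bsup>p-1\<^esup>\<close>. Each \<open>X\<^sub>k\<close> is split into its value clipped to \<open>[-a\<^sub>n, a\<^sub>n]\<close> and the
remainder, whose absolute value is the excess \<open>(\<bar>X\<^sub>k\<bar> - a\<^sub>n)\<^sup>+\<close>. The level \<open>a\<^sub>n\<close> is high
enough for the remainder to be controlled by first moments alone, and low enough for an exponential
bound on the clipped variables that beats the polynomial growth of \<open>M\<^sub>n\<close>.

Remainder. The weights are bounded, so it is enough to bound the sum over \<open>k \<le> n\<close> of the excesses,
divided by \<open>b\<^sub>n\<close>. Since \<open>a\<^sub>n\<close> and \<open>b\<^sub>n\<close> increase, for \<open>2\<^sup>m \<le> n < 2\<^bsup>m+1\<^esup>\<close> this is at most a variable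
\<open>W\<^sub>m\<close>, in which the sum runs up to \<open>2\<^bsup>m+1\<^esup>\<close> and the levels are those at \<open>2\<^sup>m\<close>. By stochastic
domination the expectation of \<open>W\<^sub>m\<close> is at most a constant times the expectation of
\<open>u\<^sub>m (\<bar>Y\<bar> - a)\<^sup>+\<close>, where \<open>a = a\<^bsub>2^m\<^esub>\<close> and \<open>u\<^sub>m = a\<^bsup>p-1\<^esup>\<close>. The \<open>u\<^sub>m\<close> grow geometrically, and only
those with \<open>u\<^sub>m < \<bar>Y\<bar>\<^bsup>p-1\<^esup>\<close> contribute, so that the sum over \<open>m\<close> is at most a constant times
\<open>\<bar>Y\<bar>\<^sup>p\<close> (\<open>dyadic_excess_sum_le\<close>). Hence the expectations of the \<open>W\<^sub>m\<close> are summable, and \<open>W\<^sub>m\<close> tends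
to zero both almost surely and in mean (\<open>normalized_excess_vanishes\<close>).

Clipped part. The orthant inequality for indicators of rays passes to products of nonnegative
continuous nondecreasing functions, one factor at a time, by integrating over superlevel sets
(\<open>orthant_bound_imp_mono_product_bound\<close>). It applies to exponentials of clipped variables with
nonnegative weights. With the parameter \<open>\<theta> = K / a\<^sub>n\<close> the exponents stay bounded, the second moments
contribute only \<open>o(Log n)\<close> in total because the second moment of \<open>min \<bar>Y\<bar> a\<close> is \<open>o(a\<^bsup>2-p\<^esup>)\<close>, and the
Chernoff bound for exceeding \<open>\<delta> b\<^sub>n\<close> is \<open>M\<^sub>n n\<^bsup>-K\<delta>+o(1)\<^esup>\<close>. This is summable if \<open>K\<close> is large, and the
first Borel--Cantelli lemma applies (\<open>orthant_clipped_sum_eventually_less\<close>). Splitting the weights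
into positive and negative parts, and using the two halves of the dependence condition for \<open>X\<close> and
for \<open>-X\<close>, gives the two-sided limit.\<close>

section \<open>Orthant inequalities for products of monotone functions\<close>

text \<open>The weight \<open>R\<close> lets the same formula serve two purposes: with \<open>R\<close> a product over the
other coordinates it allows one coordinate of a joint inequality to be changed while the others are
kept, and with \<open>R\<close> constant it compares moments of two different variables.\<close>

lemma layer_cake_nn_integral:
  assumes "sigma_finite_measure M"
    and [measurable]: "h \<in> borel_measurable M" "R \<in> borel_measurable M"
  shows "(\<integral>\<^sup>+\<omega>. ennreal (h \<omega>) * R \<omega> \<partial>M) =
    (\<integral>\<^sup>+t. (\<integral>\<^sup>+\<omega>. indicator {\<omega>. h \<omega> > t} \<omega> * R \<omega> \<partial>M) * indicator {0<..} t \<partial>(lborel :: real measure))"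
proof -
  interpret M: sigma_finite_measure M by fact
  interpret pair_sigma_finite M "lborel :: real measure" ..
  have len: "ennreal (h \<omega>) = (\<integral>\<^sup>+t. indicator {0<..<h \<omega>} t \<partial>lborel)" for \<omega>
    by (cases "h \<omega> \<ge> 0") (simp_all add: ennreal_neg)
  have "(\<integral>\<^sup>+\<omega>. ennreal (h \<omega>) * R \<omega> \<partial>M) =
      (\<integral>\<^sup>+\<omega>. (\<integral>\<^sup>+t. indicator {0<..<h \<omega>} t * R \<omega> \<partial>lborel) \<partial>M)"
    by (simp add: len nn_integral_multc)
  also have "\<dots> = (\<integral>\<^sup>+t. (\<integral>\<^sup>+\<omega>. indicator {0<..<h \<omega>} t * R \<omega> \<partial>M) \<partial>lborel)"
  proof (rule Fubini'[symmetric])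
    have "(\<lambda>(\<omega>, t). indicator {0<..<h \<omega>} t * R \<omega>) =
        (\<lambda>z. (if 0 < snd z \<and> snd z < h (fst z) then R (fst z) else 0))"
      by (auto simp: fun_eq_iff indicator_def)
    then show "(\<lambda>(\<omega>, t). indicator {0<..<h \<omega>} t * R \<omega>) \<in> borel_measurable (M \<Otimes>\<^sub>M lborel)"
      by simp
  qed
  also have "\<dots> = (\<integral>\<^sup>+t. (\<integral>\<^sup>+\<omega>. (indicator {\<omega>. h \<omega> > t} \<omega> * R \<omega>) * indicator {0<..} t \<partial>M) \<partial>lborel)"
    by (intro nn_integral_cong) (auto simp: indicator_def)
  also have "\<dots> = (\<integral>\<^sup>+t. (\<integral>\<^sup>+\<omega>. indicator {\<omega>. h \<omega> > t} \<omega> * R \<omega> \<partial>M) * indicator {0<..} t \<partial>lborel)"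
    by (intro nn_integral_cong nn_integral_multc) simp
  finally show ?thesis .
qed

lemma open_upper_set_real_cases:
  fixes U :: "real set"
  assumes "open U" and up: "\<And>x y. x \<in> U \<Longrightarrow> x \<le> y \<Longrightarrow> y \<in> U"
  shows "U = {} \<or> U = UNIV \<or> (\<exists>s. U = {s<..})"
proof (cases "U = {} \<or> U = UNIV")
  case False
  then obtain z u where z: "z \<notin> U" and u: "u \<in> U" by auto
  have bdd: "bdd_below U" using z up by (meson bdd_below.I linear)
  have "x \<in> U \<longleftrightarrow> Inf U < x" for x
  proof
    assume x: "x \<in> U"
    then obtain e where e: "e > 0" "cball x e \<subseteq> U" using \<open>open U\<close> open_contains_cball by blast
    then have "x - e \<in> U" by (auto simp: dist_real_def subset_iff)
    then show "Inf U < x" using cInf_lower[OF _ bdd, of "x - e"] e by simp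
  next
    assume "Inf U < x"
    then obtain y where "y \<in> U" "y < x" using cInf_lessD[of U x] u by auto
    then show "x \<in> U" using up by simp
  qed
  then have "U = {Inf U<..}" by auto
  then show ?thesis by blast
qed auto

text \<open>The superlevel sets of \<open>g\<close> are open upper sets, that is, open rays, the whole line or empty.
Continuity of \<open>g\<close> is what excludes closed rays. The bound for the whole line is the limit of the
bounds for the rays \<open>{-i<..}\<close>. Integrating over the levels gives the claim.\<close>

lemma weighted_ray_bound_imp_mono_bound:
  fixes g :: "real \<Rightarrow> real" and B :: ennreal
  assumes "sigma_finite_measure M"
    and [measurable]: "Z \<in> borel_measurable M" "R \<in> borel_measurable M"
    and g: "continuous_on UNIV g" "mono g"
    and ray: "\<And>x. (\<integral>\<^sup>+\<omega>. indicator {x<..} (Z \<omega>) * R \<omega> \<partial>M) \<le> B * emeasure M {\<omega>\<in>space M. Z \<omega> > x}"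
  shows "(\<integral>\<^sup>+\<omega>. ennreal (g (Z \<omega>)) * R \<omega> \<partial>M) \<le> B * (\<integral>\<^sup>+\<omega>. ennreal (g (Z \<omega>)) \<partial>M)"
proof -
  interpret M: sigma_finite_measure M by fact
  have [measurable]: "g \<in> borel_measurable borel"
    using g(1) by (rule borel_measurable_continuous_onI)
  have total: "(\<integral>\<^sup>+\<omega>. R \<omega> \<partial>M) \<le> B * emeasure M (space M)"
  proof -
    have "(\<integral>\<^sup>+\<omega>. R \<omega> \<partial>M) = (\<integral>\<^sup>+\<omega>. (SUP i. indicator {- real i<..} (Z \<omega>) * R \<omega>) \<partial>M)"
    proof (rule nn_integral_cong)
      fix \<omega> assume "\<omega> \<in> space M"
      obtain i where "- Z \<omega> < real i" using reals_Archimedean2 by blast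
      then have "indicator {- real i<..} (Z \<omega>) * R \<omega> = R \<omega>" by simp
      moreover have "indicator {- real j<..} (Z \<omega>) * R \<omega> \<le> R \<omega>" for j
        by (simp add: indicator_def)
      ultimately show "R \<omega> = (SUP i. indicator {- real i<..} (Z \<omega>) * R \<omega>)"
        by (metis (no_types, lifting) SUP_eqI UNIV_I)
    qed
    also have "\<dots> = (SUP i. \<integral>\<^sup>+\<omega>. indicator {- real i<..} (Z \<omega>) * R \<omega> \<partial>M)"
      by (rule nn_integral_monotone_convergence_SUP)
         (auto simp: incseq_def le_fun_def indicator_def)
    also have "\<dots> \<le> B * emeasure M (space M)"
      by (intro SUP_least order_trans[OF ray] mult_left_mono emeasure_mono) auto
    finally show ?thesis .
  qed
  have level: "(\<integral>\<^sup>+\<omega>. indicator {\<omega>. g (Z \<omega>) > t} \<omega> * R \<omega> \<partial>M) \<le>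
      (\<integral>\<^sup>+\<omega>. indicator {\<omega>. g (Z \<omega>) > t} \<omega> * B \<partial>M)" for t
  proof -
    have rhs: "(\<integral>\<^sup>+\<omega>. indicator {\<omega>. g (Z \<omega>) > t} \<omega> * B \<partial>M) =
        B * emeasure M {\<omega>\<in>space M. g (Z \<omega>) > t}"
    proof -
      have "(\<integral>\<^sup>+\<omega>. indicator {\<omega>. g (Z \<omega>) > t} \<omega> * B \<partial>M) =
          (\<integral>\<^sup>+\<omega>. B * indicator {\<omega>\<in>space M. g (Z \<omega>) > t} \<omega> \<partial>M)"
        by (intro nn_integral_cong) (auto simp: indicator_def)
      also have "\<dots> = B * emeasure M {\<omega>\<in>space M. g (Z \<omega>) > t}"
        by (rule nn_integral_cmult_indicator) measurable
      finally show ?thesis .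
    qed
    have "open {x. g x > t}"
      using g(1) by (intro open_Collect_less) auto
    moreover have "y \<in> {x. g x > t}" if "x \<in> {x. g x > t}" "x \<le> y" for x y
      using that monoD[OF g(2), of x y] by simp
    ultimately have "{x. g x > t} = {} \<or> {x. g x > t} = UNIV \<or> (\<exists>s. {x. g x > t} = {s<..})"
      by (rule open_upper_set_real_cases)
    then consider "{x. g x > t} = {}" | "{x. g x > t} = UNIV" | s where "{x. g x > t} = {s<..}"
      by blast
    then show ?thesis
    proof cases
      case 1
      then have "\<not> g x > t" for x by blast
      then show ?thesis by simp
    next
      case 2
      then have "g x > t" for x by blast
      then show ?thesis unfolding rhs using total by simp
    next
      case 3
      then have "g x > t \<longleftrightarrow> x > s" for x by (metis greaterThan_iff mem_Collect_eq)
      then show ?thesis unfolding rhs using ray[of s]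
        by (simp add: indicator_def)
    qed
  qed
  have "(\<integral>\<^sup>+\<omega>. ennreal (g (Z \<omega>)) * R \<omega> \<partial>M) \<le> (\<integral>\<^sup>+\<omega>. ennreal (g (Z \<omega>)) * B \<partial>M)"
    unfolding layer_cake_nn_integral[of M "\<lambda>\<omega>. g (Z \<omega>)", OF assms(1)]
    by (subst (1 2) layer_cake_nn_integral[OF assms(1)])
       (auto intro!: nn_integral_mono mult_right_mono level)
  also have "\<dots> = (\<integral>\<^sup>+\<omega>. ennreal (g (Z \<omega>)) \<partial>M) * B"
    by (rule nn_integral_multc) measurable
  finally show ?thesis by (simp only: mult.commute[of B])
qed

text \<open>The indicators are replaced by the functions \<open>f k\<close> one coordinate at a time. The factors of the
remaining coordinates form the weight \<open>R\<close> of the preceding lemma; the thresholds \<open>x\<close> are kept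
universally quantified in the induction, since the coordinate being replaced must be free to range
over all rays.\<close>

lemma orthant_bound_imp_mono_product_bound:
  fixes Z :: "nat \<Rightarrow> 'a \<Rightarrow> real" and f :: "nat \<Rightarrow> real \<Rightarrow> real" and B :: ennreal
  assumes "sigma_finite_measure M" and I: "finite I"
    and Z: "\<And>k. k \<in> I \<Longrightarrow> Z k \<in> borel_measurable M"
    and f: "\<And>k. k \<in> I \<Longrightarrow> continuous_on UNIV (f k)" "\<And>k. k \<in> I \<Longrightarrow> mono (f k)"
    and orth: "\<And>x. emeasure M {\<omega>\<in>space M. \<forall>k\<in>I. Z k \<omega> > x k} \<le>
        B * (\<Prod>k\<in>I. emeasure M {\<omega>\<in>space M. Z k \<omega> > x k})"
  shows "(\<integral>\<^sup>+\<omega>. (\<Prod>k\<in>I. ennreal (f k (Z k \<omega>))) \<partial>M) \<le>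
    B * (\<Prod>k\<in>I. \<integral>\<^sup>+\<omega>. ennreal (f k (Z k \<omega>)) \<partial>M)"
proof -
  have fm: "f k \<in> borel_measurable borel" if "k \<in> I" for k
    using f(1)[OF that] by (rule borel_measurable_continuous_onI)
  have "\<forall>x. (\<integral>\<^sup>+\<omega>. (\<Prod>k\<in>J. ennreal (f k (Z k \<omega>))) * (\<Prod>k\<in>I-J. indicator {x k<..} (Z k \<omega>)) \<partial>M) \<le>
      B * ((\<Prod>k\<in>J. \<integral>\<^sup>+\<omega>. ennreal (f k (Z k \<omega>)) \<partial>M) *
        (\<Prod>k\<in>I-J. emeasure M {\<omega>\<in>space M. Z k \<omega> > x k}))" if "J \<subseteq> I" for J
    using finite_subset[OF that I] that
  proof (induction J rule: finite_induct)
    case empty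
    have "(\<integral>\<^sup>+\<omega>. (\<Prod>k\<in>I. indicator {x k<..} (Z k \<omega>)) \<partial>M) =
        emeasure M {\<omega>\<in>space M. \<forall>k\<in>I. Z k \<omega> > x k}" for x
    proof -
      have 1: "(\<Prod>k\<in>I. indicator {x k<..} (Z k \<omega>) :: ennreal) =
          indicator {\<omega>\<in>space M. \<forall>k\<in>I. Z k \<omega> > x k} \<omega>" if "\<omega> \<in> space M" for \<omega>
        using that I by (auto simp: indicator_def prod_zero_iff)
      have "{\<omega>\<in>space M. \<forall>k\<in>I. Z k \<omega> > x k} \<in> sets M"
        using I Z by measurable
      then show ?thesis by (simp add: 1 cong: nn_integral_cong)
    qed
    then show ?case using orth by simp
  next
    case (insert j J)
    define K where "K = I - insert j J"
    have j: "j \<in> I" "j \<notin> J" "J \<subseteq> I" and K: "I - J = insert j K" "j \<notin> K" "finite K" "K \<subseteq> I"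
      using insert I by (auto simp: K_def)
    have [measurable]: "Z j \<in> borel_measurable M" using Z j by auto
    show ?case
    proof
      fix x
      define R where "R \<omega> = (\<Prod>k\<in>J. ennreal (f k (Z k \<omega>))) * (\<Prod>k\<in>K. indicator {x k<..} (Z k \<omega>))" for \<omega>
      define b where "b = (\<Prod>k\<in>J. \<integral>\<^sup>+\<omega>. ennreal (f k (Z k \<omega>)) \<partial>M) *
        (\<Prod>k\<in>K. emeasure M {\<omega>\<in>space M. Z k \<omega> > x k})"
      have Rm: "R \<in> borel_measurable M"
      proof -
        have [measurable]: "Z k \<in> borel_measurable M" "f k \<in> borel_measurable borel"
          if "k \<in> J \<union> K" for k
          using that K(4) j(3) Z fm by auto
        show ?thesis unfolding R_def by measurable
      qed
      have "(\<integral>\<^sup>+\<omega>. indicator {y<..} (Z j \<omega>) * R \<omega> \<partial>M) \<le> B * b * emeasure M {\<omega>\<in>space M. Z j \<omega> > y}" for y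
      proof -
        have "(\<Prod>k\<in>K. indicator {(x(j:=y)) k<..} (Z k \<omega>)) = (\<Prod>k\<in>K. indicator {x k<..} (Z k \<omega>) :: ennreal)"
          "(\<Prod>k\<in>K. emeasure M {\<omega>\<in>space M. Z k \<omega> > (x(j:=y)) k}) = (\<Prod>k\<in>K. emeasure M {\<omega>\<in>space M. Z k \<omega> > x k})" for \<omega>
          using K(2) by (auto intro!: prod.cong)
        then show ?thesis
          using insert.IH[OF j(3), THEN spec, of "x(j:=y)"] K
          by (simp add: R_def b_def mult_ac)
      qed
      from weighted_ray_bound_imp_mono_bound[OF assms(1) _ Rm f(1,2)[OF j(1)] this]
      show "(\<integral>\<^sup>+\<omega>. (\<Prod>k\<in>insert j J. ennreal (f k (Z k \<omega>))) * (\<Prod>k\<in>I-insert j J. indicator {x k<..} (Z k \<omega>)) \<partial>M) \<le>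
        B * ((\<Prod>k\<in>insert j J. \<integral>\<^sup>+\<omega>. ennreal (f k (Z k \<omega>)) \<partial>M) *
        (\<Prod>k\<in>I-insert j J. emeasure M {\<omega>\<in>space M. Z k \<omega> > x k}))"
        using insert(1,2) by (simp add: R_def b_def K_def mult_ac)
    qed
  qed
  from this[of I] show ?thesis by simp
qed

section \<open>An exponential tail bound for clipped variables\<close>

lemma exp_le_quadratic:
  fixes z :: real
  assumes "\<bar>z\<bar> \<le> b"
  shows "exp z \<le> 1 + z + exp b * z\<^sup>2"
proof -
  obtain t where t: "\<bar>t\<bar> \<le> \<bar>z\<bar>" "exp z = (\<Sum>m<2. z ^ m / fact m) + exp t / fact 2 * z ^ 2"
    using Maclaurin_exp_le[of z 2] by blast
  have "exp t / 2 \<le> exp b" using t(1) assms by (smt (verit) exp_gt_zero exp_le_cancel_iff field_sum_of_halves)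
  then have "exp t / 2 * z\<^sup>2 \<le> exp b * z\<^sup>2" by (rule mult_right_mono) simp
  then show ?thesis using t(2) by (simp add: numeral_2_eq_2)
qed

text \<open>In \<open>exp z \<le> 1 + z + exp b * z\<^sup>2\<close>, with \<open>z\<close> the scaled centered variable and \<open>b = 2 \<theta> a\<close>, the linear
term has mean zero and the quadratic one is a variance, hence at most the second moment.\<close>

lemma (in prob_space) centered_mgf_le:
  fixes Z :: "'a \<Rightarrow> real"
  assumes [measurable]: "Z \<in> borel_measurable M" and "\<And>\<omega>. \<omega> \<in> space M \<Longrightarrow> \<bar>Z \<omega>\<bar> \<le> a" and "\<theta> \<ge> 0"
  shows "expectation (\<lambda>\<omega>. exp (\<theta> * (Z \<omega> - expectation Z))) \<le>
    exp (exp (2 * \<theta> * a) * \<theta>\<^sup>2 * expectation (\<lambda>\<omega>. (Z \<omega>)\<^sup>2))"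
proof -
  have bd: "AE \<omega> in M. norm (Z \<omega>) \<le> a" using assms(2) by (auto intro: AE_I2)
  have int: "integrable M Z" by (rule integrable_const_bound[OF bd]) simp
  have int2: "integrable M (\<lambda>\<omega>. (Z \<omega>)\<^sup>2)"
  proof (rule integrable_const_bound[of _ "a\<^sup>2"])
    show "AE \<omega> in M. norm ((Z \<omega>)\<^sup>2) \<le> a\<^sup>2"
      using power_mono[OF assms(2) abs_ge_zero, of _ 2] by (intro AE_I2) simp
  qed simp
  define \<mu> where "\<mu> = expectation Z"
  have "\<bar>\<mu>\<bar> \<le> expectation (\<lambda>\<omega>. \<bar>Z \<omega>\<bar>)" unfolding \<mu>_def by (rule integral_abs_bound)
  also have "\<dots> \<le> expectation (\<lambda>\<omega>. a)"
    using int assms(2) by (intro integral_mono) auto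
  finally have \<mu>: "\<bar>\<mu>\<bar> \<le> a" by (simp add: prob_space)
  have b: "\<bar>\<theta> * (Z \<omega> - \<mu>)\<bar> \<le> 2 * \<theta> * a" if "\<omega> \<in> space M" for \<omega>
  proof -
    have "\<bar>Z \<omega> - \<mu>\<bar> \<le> 2 * a" using assms(2)[OF that] \<mu> by linarith
    then show ?thesis using mult_left_mono[of _ _ \<theta>] assms(3) by (fastforce simp: abs_mult)
  qed
  have inte: "integrable M (\<lambda>\<omega>. exp (\<theta> * (Z \<omega> - \<mu>)))"
    by (rule integrable_const_bound[of _ "exp (2 * \<theta> * a)"])
       (use b in \<open>auto intro!: AE_I2 intro: order_trans[OF abs_ge_self]\<close>)
  have intc: "integrable M (\<lambda>\<omega>. (Z \<omega> - \<mu>)\<^sup>2)"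
    using int int2 by (simp add: power2_diff)
  have var: "expectation (\<lambda>\<omega>. (Z \<omega> - \<mu>)\<^sup>2) \<le> expectation (\<lambda>\<omega>. (Z \<omega>)\<^sup>2)"
    using variance_eq[OF int int2] by (simp add: \<mu>_def)
  have "expectation (\<lambda>\<omega>. exp (\<theta> * (Z \<omega> - \<mu>))) \<le>
      expectation (\<lambda>\<omega>. 1 + \<theta> * (Z \<omega> - \<mu>) + exp (2 * \<theta> * a) * \<theta>\<^sup>2 * (Z \<omega> - \<mu>)\<^sup>2)"
    using exp_le_quadratic[OF b] inte intc int
    by (intro integral_mono) (auto simp: power_mult_distrib mult_ac)
  also have "\<dots> = 1 + exp (2 * \<theta> * a) * \<theta>\<^sup>2 * expectation (\<lambda>\<omega>. (Z \<omega> - \<mu>)\<^sup>2)"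
    using int intc by (simp add: prob_space \<mu>_def)
  also have "\<dots> \<le> 1 + exp (2 * \<theta> * a) * \<theta>\<^sup>2 * expectation (\<lambda>\<omega>. (Z \<omega>)\<^sup>2)"
    using var by (intro add_left_mono mult_left_mono) auto
  also have "\<dots> \<le> exp (exp (2 * \<theta> * a) * \<theta>\<^sup>2 * expectation (\<lambda>\<omega>. (Z \<omega>)\<^sup>2))"
    by (rule exp_ge_add_one_self)
  finally show ?thesis by (simp add: \<mu>_def)
qed

definition clip :: "real \<Rightarrow> real \<Rightarrow> real" where
  "clip a x = max (- a) (min a x)"

lemma abs_clip: "a \<ge> 0 \<Longrightarrow> \<bar>clip a x\<bar> = min \<bar>x\<bar> a"
  by (auto simp: clip_def)

lemma clip_minus: "a \<ge> 0 \<Longrightarrow> clip a (- x) = - clip a x"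
  by (auto simp: clip_def)

lemma abs_diff_clip: "a \<ge> 0 \<Longrightarrow> \<bar>x - clip a x\<bar> = max 0 (\<bar>x\<bar> - a)"
  by (auto simp: clip_def)

lemma clip_measurable [measurable]: "clip a \<in> borel_measurable borel"
  unfolding clip_def[abs_def] by measurable

text \<open>The Chernoff bound. Nonnegative weights make every factor of the exponential moment a
nondecreasing function of its variable, so the orthant inequality turns the moment of the product
into \<open>B\<close> times the product of the moments.\<close>

lemma (in prob_space) orthant_clipped_sum_tail:
  fixes Z :: "nat \<Rightarrow> 'a \<Rightarrow> real" and w :: "nat \<Rightarrow> real"
  assumes I: "finite I"
    and Z: "\<And>k. k \<in> I \<Longrightarrow> Z k \<in> borel_measurable M"
    and orth: "\<And>x. \<P>(\<omega> in M. \<forall>k\<in>I. Z k \<omega> > x k) \<le> B * (\<Prod>k\<in>I. \<P>(\<omega> in M. Z k \<omega> > x k))"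
    and "B \<ge> 0" "a \<ge> 0" "\<theta> \<ge> 0"
    and w: "\<And>k. k \<in> I \<Longrightarrow> 0 \<le> w k" "\<And>k. k \<in> I \<Longrightarrow> w k \<le> C"
    and v: "\<And>k. k \<in> I \<Longrightarrow> expectation (\<lambda>\<omega>. (clip a (Z k \<omega>))\<^sup>2) \<le> v"
  shows "\<P>(\<omega> in M. s \<le> (\<Sum>k\<in>I. w k * (clip a (Z k \<omega>) - expectation (\<lambda>\<omega>. clip a (Z k \<omega>))))) \<le>
    B * exp (real (card I) * (exp (2 * (\<theta> * C) * a) * (\<theta> * C)\<^sup>2 * v) - \<theta> * s)"
proof -
  define \<mu> where "\<mu> k = expectation (\<lambda>\<omega>. clip a (Z k \<omega>))" for k
  define f where "f k x = exp (\<theta> * w k * (clip a x - \<mu> k))" for k x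
  define S where "S \<omega> = (\<Sum>k\<in>I. w k * (clip a (Z k \<omega>) - \<mu> k))" for \<omega>
  have [measurable]: "S \<in> borel_measurable M"
    unfolding S_def
  proof (rule borel_measurable_sum)
    fix k assume "k \<in> I"
    then have [measurable]: "Z k \<in> borel_measurable M" by (rule Z)
    show "(\<lambda>\<omega>. w k * (clip a (Z k \<omega>) - \<mu> k)) \<in> borel_measurable M" by measurable
  qed
  have f: "continuous_on UNIV (f k)" "mono (f k)" if "k \<in> I" for k
    unfolding f_def clip_def
    using w(1)[OF that] \<open>\<theta> \<ge> 0\<close>
    by (auto intro!: continuous_intros monoI mult_left_mono)
  have orth': "emeasure M {\<omega>\<in>space M. \<forall>k\<in>I. Z k \<omega> > x k} \<le>
      ennreal B * (\<Prod>k\<in>I. emeasure M {\<omega>\<in>space M. Z k \<omega> > x k})" for x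
  proof -
    have "ennreal B * (\<Prod>k\<in>I. emeasure M {\<omega>\<in>space M. Z k \<omega> > x k}) =
        ennreal (B * (\<Prod>k\<in>I. \<P>(\<omega> in M. Z k \<omega> > x k)))"
      using \<open>B \<ge> 0\<close> by (simp add: emeasure_eq_measure prod_ennreal ennreal_mult prod_nonneg)
    then show ?thesis using orth[of x] by (simp add: emeasure_eq_measure ennreal_leI)
  qed
  have mgf: "(\<integral>\<^sup>+\<omega>. ennreal (f k (Z k \<omega>)) \<partial>M) \<le> ennreal (exp (exp (2 * (\<theta> * C) * a) * (\<theta> * C)\<^sup>2 * v))"
    if k: "k \<in> I" for k
  proof -
    have [measurable]: "Z k \<in> borel_measurable M" using Z k .
    have Zb: "\<bar>clip a (Z k \<omega>)\<bar> \<le> a" for \<omega> using \<open>a \<ge> 0\<close> by (simp add: abs_clip)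
    have wl: "0 \<le> \<theta> * w k" "\<theta> * w k \<le> \<theta> * C" "0 \<le> \<theta> * C"
      using w[OF k] \<open>\<theta> \<ge> 0\<close> by (auto intro: mult_left_mono)
    have m0: "\<bar>\<mu> k\<bar> \<le> a"
    proof -
      have "\<bar>\<mu> k\<bar> \<le> expectation (\<lambda>\<omega>. \<bar>clip a (Z k \<omega>)\<bar>)" unfolding \<mu>_def by (rule integral_abs_bound)
      also have "\<dots> \<le> expectation (\<lambda>\<omega>. a)"
        by (intro integral_mono integrable_const_bound[of _ a]) (use Zb \<open>a \<ge> 0\<close> in auto)
      finally show ?thesis by (simp add: prob_space)
    qed
    have "integrable M (\<lambda>\<omega>. f k (Z k \<omega>))"
      unfolding f_def
    proof (rule integrable_const_bound[of _ "exp (\<theta> * w k * (2 * a))"])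
      show "AE \<omega> in M. norm (exp (\<theta> * w k * (clip a (Z k \<omega>) - \<mu> k))) \<le> exp (\<theta> * w k * (2 * a))"
        using wl(1) m0 Zb by (intro AE_I2) (auto intro!: mult_left_mono, smt (verit))
    qed measurable
    then have "(\<integral>\<^sup>+\<omega>. ennreal (f k (Z k \<omega>)) \<partial>M) = ennreal (expectation (\<lambda>\<omega>. f k (Z k \<omega>)))"
      by (rule nn_integral_eq_integral) (simp add: f_def)
    also have "expectation (\<lambda>\<omega>. f k (Z k \<omega>)) \<le>
        exp (exp (2 * (\<theta> * w k) * a) * (\<theta> * w k)\<^sup>2 * expectation (\<lambda>\<omega>. (clip a (Z k \<omega>))\<^sup>2))"
      unfolding f_def \<mu>_def by (rule centered_mgf_le) (use Zb wl in auto)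
    also have "\<dots> \<le> exp (exp (2 * (\<theta> * C) * a) * (\<theta> * C)\<^sup>2 * v)"
    proof -
      have "exp (2 * (\<theta> * w k) * a) \<le> exp (2 * (\<theta> * C) * a)"
        using mult_right_mono[OF wl(2) \<open>a \<ge> 0\<close>] by (simp add: mult.assoc)
      moreover have "(\<theta> * w k)\<^sup>2 \<le> (\<theta> * C)\<^sup>2"
        using wl by (intro power_mono)
      ultimately have "exp (2 * (\<theta> * w k) * a) * (\<theta> * w k)\<^sup>2 \<le> exp (2 * (\<theta> * C) * a) * (\<theta> * C)\<^sup>2"
        by (rule mult_mono) auto
      then have "exp (2 * (\<theta> * w k) * a) * (\<theta> * w k)\<^sup>2 * expectation (\<lambda>\<omega>. (clip a (Z k \<omega>))\<^sup>2) \<le>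
          exp (2 * (\<theta> * C) * a) * (\<theta> * C)\<^sup>2 * v"
        using v[OF k] by (rule mult_mono) auto
      then show ?thesis by simp
    qed
    finally show ?thesis by (simp add: ennreal_leI)
  qed
  have "(\<integral>\<^sup>+\<omega>. ennreal (exp (\<theta> * S \<omega>)) \<partial>M) = (\<integral>\<^sup>+\<omega>. (\<Prod>k\<in>I. ennreal (f k (Z k \<omega>))) \<partial>M)"
    by (simp add: f_def S_def prod_ennreal sum_distrib_left exp_sum[OF I] mult.assoc)
  also have "\<dots> \<le> ennreal B * (\<Prod>k\<in>I. \<integral>\<^sup>+\<omega>. ennreal (f k (Z k \<omega>)) \<partial>M)"
    by (rule orthant_bound_imp_mono_product_bound[OF sigma_finite_measure_axioms I Z f orth'])
  also have "\<dots> \<le> ennreal B * (\<Prod>k\<in>I. ennreal (exp (exp (2 * (\<theta> * C) * a) * (\<theta> * C)\<^sup>2 * v)))"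
    by (intro mult_left_mono prod_mono_ennreal mgf) auto
  also have "\<dots> = ennreal (B * exp (real (card I) * (exp (2 * (\<theta> * C) * a) * (\<theta> * C)\<^sup>2 * v)))"
    using \<open>B \<ge> 0\<close> by (simp add: ennreal_power ennreal_mult exp_of_nat_mult)
  finally have E: "(\<integral>\<^sup>+\<omega>. ennreal (exp (\<theta> * S \<omega>)) \<partial>M) \<le>
    ennreal (B * exp (real (card I) * (exp (2 * (\<theta> * C) * a) * (\<theta> * C)\<^sup>2 * v)))" .
  have "emeasure M {\<omega>\<in>space M. s \<le> S \<omega>} = (\<integral>\<^sup>+\<omega>. indicator {\<omega>\<in>space M. s \<le> S \<omega>} \<omega> \<partial>M)"
    by simp
  also have "\<dots> \<le> (\<integral>\<^sup>+\<omega>. ennreal (exp (- \<theta> * s)) * ennreal (exp (\<theta> * S \<omega>)) \<partial>M)"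
  proof (rule nn_integral_mono)
    fix \<omega>
    have "1 \<le> ennreal (exp (- \<theta> * s)) * ennreal (exp (\<theta> * S \<omega>))" if "s \<le> S \<omega>"
    proof -
      have "1 \<le> exp (- \<theta> * s + \<theta> * S \<omega>)"
        using mult_left_mono[OF that \<open>\<theta> \<ge> 0\<close>] by simp
      then show ?thesis by (simp flip: ennreal_mult exp_add)
    qed
    then show "indicator {\<omega>\<in>space M. s \<le> S \<omega>} \<omega> \<le> ennreal (exp (- \<theta> * s)) * ennreal (exp (\<theta> * S \<omega>))"
      by (auto simp: indicator_def)
  qed
  also have "\<dots> = ennreal (exp (- \<theta> * s)) * (\<integral>\<^sup>+\<omega>. ennreal (exp (\<theta> * S \<omega>)) \<partial>M)"
    by (rule nn_integral_cmult) simp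
  also have "\<dots> \<le> ennreal (exp (- \<theta> * s)) *
    ennreal (B * exp (real (card I) * (exp (2 * (\<theta> * C) * a) * (\<theta> * C)\<^sup>2 * v)))"
    by (intro mult_left_mono E) simp
  also have "\<dots> = ennreal (B * exp (real (card I) * (exp (2 * (\<theta> * C) * a) * (\<theta> * C)\<^sup>2 * v) - \<theta> * s))"
    using \<open>B \<ge> 0\<close> by (simp add: exp_diff exp_minus field_simps flip: ennreal_mult)
  finally show ?thesis
    using \<open>B \<ge> 0\<close> by (simp add: emeasure_eq_measure S_def \<mu>_def)
qed

section \<open>Truncation levels and their dyadic growth\<close>

lemma Log_ge_1: "Log x \<ge> 1"
proof -
  have "ln (exp 1) \<le> ln (max x (exp 1))" by (rule ln_mono) (auto simp: less_max_iff_disj)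
  then show ?thesis by (simp add: Log_def)
qed

lemma Log_mono: "x \<le> y \<Longrightarrow> Log x \<le> Log y"
  unfolding Log_def by (intro ln_mono) (auto simp: less_max_iff_disj)

lemma Log_double_le:
  assumes "x \<ge> 0"
  shows "Log (2 * x) \<le> (1 + ln 2) * Log x"
proof -
  have "Log (2 * x) \<le> ln (2 * max x (exp 1))"
    unfolding Log_def using assms by (intro ln_mono) (auto simp: less_max_iff_disj)
  also have "\<dots> = ln 2 + Log x"
    unfolding Log_def by (rule ln_mult_pos) (auto simp: less_max_iff_disj)
  also have "\<dots> \<le> ln 2 * Log x + Log x"
    using mult_left_mono[OF Log_ge_1[of x], of "ln 2"] by simp
  finally show ?thesis by (simp add: algebra_simps)
qed

lemma Log_eq_ln: "n \<ge> 3 \<Longrightarrow> Log (real n) = ln (real n)"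
  unfolding Log_def using exp_le by (simp add: max_def)

text \<open>Above \<open>exp 1\<close> the quotient \<open>x / ln x\<close> increases, and below it the denominator is constant.\<close>

lemma Log_div_mono:
  assumes "0 \<le> x" "x \<le> y"
  shows "x / Log x \<le> y / Log y"
proof -
  have L: "Log x > 0" "Log y > 0" using Log_ge_1[of x] Log_ge_1[of y] by auto
  show ?thesis
  proof (cases "y \<le> exp 1")
    case True
    then show ?thesis using assms by (simp add: Log_def max_def)
  next
    case False
    define z where "z = max x (exp 1)"
    have z: "z \<ge> exp 1" "z \<le> y" "x \<le> z" "Log x = ln z" "Log y = ln y" "z > 0"
      using False assms by (auto simp: z_def Log_def less_max_iff_disj)
    have "ln y = ln z + ln (y / z)" using z(2,6) by (simp add: ln_div)
    also have "\<dots> \<le> ln z + (y / z - 1)" using z(2,6) ln_le_minus_one[of "y / z"] by simp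
    also have "\<dots> \<le> ln z + (y / z - 1) * ln z"
      using mult_left_mono[of 1 "ln z" "y / z - 1"] z L Log_ge_1[of x] by simp
    also have "\<dots> = y / z * ln z" by (simp add: algebra_simps)
    finally have "z * ln y \<le> y * ln z" using z(6) by (simp add: field_simps)
    then have "x * ln y \<le> y * ln z"
      using mult_right_mono[OF z(3), of "ln y"] L z(5) by linarith
    then show ?thesis using L z(4,5) by (simp add: field_simps)
  qed
qed

text \<open>The truncation level: the normalizer divided by \<open>Log n\<close>, see \<open>level_mult_Log\<close>.\<close>

definition level :: "real \<Rightarrow> nat \<Rightarrow> real" where
  "level p n = (real n / Log (real n)) powr (1 / p)"

lemma level_nonneg: "level p n \<ge> 0"
  by (simp add: level_def)

lemma level_pos: "n \<ge> 1 \<Longrightarrow> level p n > 0"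
  using Log_ge_1[of "real n"] by (simp add: level_def)

lemma level_mono: "p > 0 \<Longrightarrow> m \<le> n \<Longrightarrow> level p m \<le> level p n"
  unfolding level_def using Log_ge_1[of "real m"] Log_div_mono[of m n]
  by (intro powr_mono2) auto

lemma level_powr: "p > 0 \<Longrightarrow> n \<ge> 1 \<Longrightarrow> level p n powr p = real n / Log (real n)"
  using Log_ge_1[of "real n"] by (simp add: level_def powr_powr)

lemma level_mult_Log:
  "level p n * Log (real n) = real n powr (1 / p) * Log (real n) powr (1 - 1 / p)"
  using Log_ge_1[of "real n"] by (simp add: level_def powr_divide powr_diff)

lemma level_powr_minus_1:
  assumes "p > 0" "n \<ge> 1"
  shows "level p n powr (p - 1) = real n / (level p n * Log (real n))"
  using assms level_pos[OF assms(2), of p] by (simp add: powr_diff level_powr)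

lemma level_at_top:
  assumes "p > 0"
  shows "filterlim (level p) at_top sequentially"
proof -
  have "filterlim (\<lambda>n::nat. (real n / ln (real n)) powr (1 / p)) at_top sequentially"
    using assms by real_asymp
  then show ?thesis
    by (rule filterlim_mono_eventually[OF _ order_refl order_refl])
       (use eventually_ge_at_top[of 3] in eventually_elim, simp add: level_def Log_eq_ln)
qed

text \<open>Under geometric growth a partial sum is at most a constant times its last term, and the last
term that is counted lies below \<open>y\<close>.\<close>

lemma geometric_growth_sum_below:
  fixes u :: "nat \<Rightarrow> real"
  assumes "q > 1" and nonneg: "\<And>m. u m \<ge> 0" and growth: "\<And>m. u (Suc m) \<ge> q * u m" and "y \<ge> 0"
  shows "(\<Sum>m<N. if u m < y then u m else 0) \<le> q / (q - 1) * y"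
proof -
  have init: "(\<Sum>m\<le>N. u m) \<le> q / (q - 1) * u N" for N
  proof (induction N)
    case 0
    have "1 \<le> q / (q - 1)" using \<open>q > 1\<close> by simp
    from mult_right_mono[OF this, of "u 0"] show ?case using nonneg by simp
  next
    case (Suc N)
    \<comment> \<open>The constant \<open>q / (q - 1)\<close> is the fixed point of \<open>C \<mapsto> C / q + 1\<close>.\<close>
    have "q / (q - 1) * u N + u (Suc N) \<le> u (Suc N) / (q - 1) + u (Suc N)"
      using growth[of N] \<open>q > 1\<close> by (simp add: divide_right_mono)
    also have "\<dots> = q / (q - 1) * u (Suc N)" using \<open>q > 1\<close> by (simp add: field_simps)
    finally show ?case using Suc by simp
  qed
  show ?thesis
  proof (induction N)
    case 0
    then show ?case using \<open>q > 1\<close> \<open>y \<ge> 0\<close> by simp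
  next
    case (Suc N)
    show ?case
    proof (cases "u N < y")
      case True
      have "(\<Sum>m<Suc N. if u m < y then u m else 0) \<le> (\<Sum>m\<le>N. u m)"
        unfolding lessThan_Suc_atMost using nonneg by (intro sum_mono) auto
      also have "\<dots> \<le> q / (q - 1) * u N" by (rule init)
      also have "\<dots> \<le> q / (q - 1) * y" using True \<open>q > 1\<close> by (intro mult_left_mono) auto
      finally show ?thesis .
    qed (use Suc in simp)
  qed
qed

text \<open>Doubling the argument multiplies \<open>Log\<close> by at most \<open>1 + ln 2\<close>, which is less than 2, so
\<open>n / Log n\<close> grows at a geometric rate along powers of two.\<close>

lemma level_dyadic_growth:
  assumes "p > 1"
  shows "level p (2 ^ Suc m) powr (p - 1) \<ge>
    (2 / (1 + ln 2)) powr ((p - 1) / p) * level p (2 ^ m) powr (p - 1)"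
proof -
  define x :: real where "x = 2 ^ m"
  have x: "x > 0" by (simp add: x_def)
  have L: "Log x > 0" "Log (2 * x) > 0" using Log_ge_1[of x] Log_ge_1[of "2 * x"] by auto
  have pos: "(0::real) < 1 + ln 2" by (simp add: add_pos_nonneg)
  have "2 / (1 + ln 2) * (x / Log x) = 2 * x / ((1 + ln 2) * Log x)" by simp
  also have "\<dots> \<le> 2 * x / Log (2 * x)"
    using Log_double_le[of x] L x by (intro divide_left_mono) auto
  finally have *: "2 / (1 + ln 2) * (x / Log x) \<le> 2 * x / Log (2 * x)" .
  have "(2 / (1 + ln 2)) powr ((p - 1) / p) * (x / Log x) powr ((p - 1) / p) =
      (2 / (1 + ln 2) * (x / Log x)) powr ((p - 1) / p)"
    by (rule powr_mult[symmetric])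
  also have "\<dots> \<le> (2 * x / Log (2 * x)) powr ((p - 1) / p)"
    using assms * pos x L by (intro powr_mono2) auto
  finally show ?thesis by (simp add: level_def powr_powr x_def)
qed

text \<open>This sum is where the choice of the level matters: \<open>level p n powr (p - 1)\<close> is \<open>n\<close> divided by the
normalizer, so the expectation of the left side at \<open>x = \<bar>Y\<bar>\<close> controls the normalized first moments of
the excesses in all dyadic blocks at once by the moment of order \<open>p\<close>.\<close>

lemma dyadic_excess_sum_le:
  fixes x :: real
  assumes "p > 1" and "x \<ge> 0"
  defines "q \<equiv> (2 / (1 + ln 2)) powr ((p - 1) / p)"
  shows "(\<Sum>m<N. level p (2 ^ m) powr (p - 1) * max 0 (x - level p (2 ^ m))) \<le> q / (q - 1) * x powr p"
proof -
  define u where "u m = level p (2 ^ m) powr (p - 1)" for m :: nat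
  have "q > 1"
    unfolding q_def using assms(1) ln2_le_25_over_36
    by (intro gr_one_powr) (auto simp: add_pos_nonneg)
  have "(\<Sum>m<N. u m * max 0 (x - level p (2 ^ m))) \<le> (\<Sum>m<N. x * (if u m < x powr (p - 1) then u m else 0))"
  proof (rule sum_mono)
    fix m
    show "u m * max 0 (x - level p (2 ^ m)) \<le> x * (if u m < x powr (p - 1) then u m else 0)"
    proof (cases "level p (2 ^ m) < x")
      case True
      then have "u m < x powr (p - 1)"
        unfolding u_def using assms(1) by (intro powr_less_mono2) (auto simp: level_nonneg)
      then show ?thesis using True assms(2)
        by (auto simp: u_def level_nonneg mult.commute[of x] intro!: mult_left_mono)
    qed (use assms(2) in \<open>auto simp: u_def\<close>)
  qed
  also have "\<dots> = x * (\<Sum>m<N. if u m < x powr (p - 1) then u m else 0)"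
    by (simp add: sum_distrib_left)
  also have "\<dots> \<le> x * (q / (q - 1) * x powr (p - 1))"
    using assms(2) \<open>q > 1\<close> level_dyadic_growth[OF assms(1)]
    by (intro mult_left_mono geometric_growth_sum_below) (auto simp: u_def q_def)
  also have "\<dots> = q / (q - 1) * x powr p"
    using assms(2) by (cases "x = 0") (auto simp: powr_diff)
  finally show ?thesis by (simp add: u_def)
qed

section \<open>Comparison of moments under stochastic domination\<close>

text \<open>Domination of tails is assumed at positive thresholds only. The hypothesis on \<open>g\<close> says that its
superlevel sets at positive heights are, within the nonnegative half-line, either empty or open
rays with a positive end point, which forces \<open>g\<close> to be nonpositive at zero.\<close>

lemma (in prob_space) nn_integral_tail_domination:
  fixes X Y :: "'a \<Rightarrow> real"
  assumes [measurable]: "X \<in> borel_measurable M" "Y \<in> borel_measurable M" "g \<in> borel_measurable borel"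
    and "C \<ge> 0"
    and dom: "\<And>t. t > 0 \<Longrightarrow> \<P>(\<omega> in M. \<bar>X \<omega>\<bar> > t) \<le> C * \<P>(\<omega> in M. \<bar>Y \<omega>\<bar> > t)"
    and g: "\<And>t. t > 0 \<Longrightarrow> (\<exists>s>0. \<forall>x\<ge>0. g x > t \<longleftrightarrow> x > s) \<or> (\<forall>x\<ge>0. g x \<le> t)"
  shows "(\<integral>\<^sup>+\<omega>. ennreal (g \<bar>X \<omega>\<bar>) \<partial>M) \<le> ennreal C * (\<integral>\<^sup>+\<omega>. ennreal (g \<bar>Y \<omega>\<bar>) \<partial>M)"
proof -
  have level: "(\<integral>\<^sup>+\<omega>. indicator {\<omega>. g \<bar>X \<omega>\<bar> > t} \<omega> * 1 \<partial>M) \<le>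
      (\<integral>\<^sup>+\<omega>. indicator {\<omega>. g \<bar>Y \<omega>\<bar> > t} \<omega> * ennreal C \<partial>M)" if "t > 0" for t
    using g[OF that]
  proof
    assume "\<exists>s>0. \<forall>x\<ge>0. g x > t \<longleftrightarrow> x > s"
    then obtain s where s: "s > 0" "\<And>x. x \<ge> 0 \<Longrightarrow> g x > t \<longleftrightarrow> x > s" by auto
    have i: "(\<integral>\<^sup>+\<omega>. indicator {\<omega>. \<bar>Z \<omega>\<bar> > s} \<omega> \<partial>M) = ennreal (\<P>(\<omega> in M. \<bar>Z \<omega>\<bar> > s))"
      if [measurable]: "Z \<in> borel_measurable M" for Z :: "'a \<Rightarrow> real"
    proof -
      have "(\<integral>\<^sup>+\<omega>. indicator {\<omega>. \<bar>Z \<omega>\<bar> > s} \<omega> \<partial>M) =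
          (\<integral>\<^sup>+\<omega>. indicator {\<omega>\<in>space M. \<bar>Z \<omega>\<bar> > s} \<omega> \<partial>M)"
        by (intro nn_integral_cong) (auto simp: indicator_def)
      then show ?thesis by (simp add: emeasure_eq_measure)
    qed
    have "(\<integral>\<^sup>+\<omega>. indicator {\<omega>. \<bar>Y \<omega>\<bar> > s} \<omega> * ennreal C \<partial>M) =
        ennreal (\<P>(\<omega> in M. \<bar>Y \<omega>\<bar> > s)) * ennreal C"
      by (subst nn_integral_multc) (auto simp: i)
    moreover have "\<dots> = ennreal (C * \<P>(\<omega> in M. \<bar>Y \<omega>\<bar> > s))"
      using \<open>C \<ge> 0\<close> by (simp add: ennreal_mult mult.commute)
    ultimately show ?thesis using dom[OF s(1)] by (simp add: s(2) i ennreal_leI)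
  next
    assume "\<forall>x\<ge>0. g x \<le> t"
    then show ?thesis by (simp add: not_less[symmetric])
  qed
  have "(\<integral>\<^sup>+\<omega>. ennreal (g \<bar>X \<omega>\<bar>) * 1 \<partial>M) \<le> (\<integral>\<^sup>+\<omega>. ennreal (g \<bar>Y \<omega>\<bar>) * ennreal C \<partial>M)"
    by (subst (1 2) layer_cake_nn_integral[OF sigma_finite_measure_axioms])
       (auto intro!: nn_integral_mono simp: indicator_def[of "{0<..}"] level[simplified])
  also have "\<dots> = (\<integral>\<^sup>+\<omega>. ennreal (g \<bar>Y \<omega>\<bar>) \<partial>M) * ennreal C"
    by (rule nn_integral_multc) measurable
  finally show ?thesis by (simp add: mult.commute)
qed

lemma (in prob_space) dominated_integral_le:
  fixes X Y :: "'a \<Rightarrow> real"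
  assumes X: "X \<in> borel_measurable M" and Y: "Y \<in> borel_measurable M" and gm: "g \<in> borel_measurable borel"
    and "C \<ge> 0"
    and dom: "\<And>t. t > 0 \<Longrightarrow> \<P>(\<omega> in M. \<bar>X \<omega>\<bar> > t) \<le> C * \<P>(\<omega> in M. \<bar>Y \<omega>\<bar> > t)"
    and g: "\<And>t. t > 0 \<Longrightarrow> (\<exists>s>0. \<forall>x\<ge>0. g x > t \<longleftrightarrow> x > s) \<or> (\<forall>x\<ge>0. g x \<le> t)"
    and nonneg: "\<And>x. x \<ge> 0 \<Longrightarrow> g x \<ge> 0"
    and int: "integrable M (\<lambda>\<omega>. g \<bar>Y \<omega>\<bar>)"
  shows "integrable M (\<lambda>\<omega>. g \<bar>X \<omega>\<bar>)"
    and "expectation (\<lambda>\<omega>. g \<bar>X \<omega>\<bar>) \<le> C * expectation (\<lambda>\<omega>. g \<bar>Y \<omega>\<bar>)"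
proof -
  note [measurable] = X Y gm
  have "(\<integral>\<^sup>+\<omega>. ennreal (g \<bar>X \<omega>\<bar>) \<partial>M) \<le> ennreal C * (\<integral>\<^sup>+\<omega>. ennreal (g \<bar>Y \<omega>\<bar>) \<partial>M)"
    by (rule nn_integral_tail_domination[OF X Y gm \<open>C \<ge> 0\<close> dom g])
  also have "\<dots> = ennreal (C * expectation (\<lambda>\<omega>. g \<bar>Y \<omega>\<bar>))"
    using \<open>C \<ge> 0\<close> int by (simp add: nn_integral_eq_integral nonneg ennreal_mult)
  finally have le: "(\<integral>\<^sup>+\<omega>. ennreal (g \<bar>X \<omega>\<bar>) \<partial>M) \<le> ennreal (C * expectation (\<lambda>\<omega>. g \<bar>Y \<omega>\<bar>))" .
  show I: "integrable M (\<lambda>\<omega>. g \<bar>X \<omega>\<bar>)"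
  proof (rule integrableI_bounded)
    have "(\<integral>\<^sup>+\<omega>. ennreal (norm (g \<bar>X \<omega>\<bar>)) \<partial>M) = (\<integral>\<^sup>+\<omega>. ennreal (g \<bar>X \<omega>\<bar>) \<partial>M)"
      by (simp add: nonneg)
    then show "(\<integral>\<^sup>+\<omega>. ennreal (norm (g \<bar>X \<omega>\<bar>)) \<partial>M) < \<infinity>"
      using le by (simp add: le_less_trans ennreal_less_top)
  qed simp
  show "expectation (\<lambda>\<omega>. g \<bar>X \<omega>\<bar>) \<le> C * expectation (\<lambda>\<omega>. g \<bar>Y \<omega>\<bar>)"
    using le \<open>C \<ge> 0\<close> I by (simp add: nn_integral_eq_integral nonneg)
qed

lemma excess_levels:
  fixes t a :: real
  assumes "t > 0" "a \<ge> 0"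
  shows "\<exists>s>0. \<forall>x\<ge>0. max 0 (x - a) > t \<longleftrightarrow> x > s"
  using assms by (intro exI[of _ "a + t"]) auto

lemma clipped_square_levels:
  fixes t a :: real
  assumes "t > 0" "a \<ge> 0"
  shows "(\<exists>s>0. \<forall>x\<ge>0. (min x a)\<^sup>2 > t \<longleftrightarrow> x > s) \<or> (\<forall>x\<ge>0. (min x a)\<^sup>2 \<le> t)"
proof -
  have *: "(min x a)\<^sup>2 > t \<longleftrightarrow> min x a > sqrt t" if "x \<ge> 0" for x
    using that assms by (metis min_def real_less_lsqrt real_sqrt_less_mono real_sqrt_unique less_eq_real_def not_less_iff_gr_or_eq)
  show ?thesis
  proof (cases "sqrt t < a")
    case True
    then show ?thesis using * assms(1) by (intro disjI1 exI[of _ "sqrt t"]) auto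
  next
    case False
    then have "\<not> (min x a)\<^sup>2 > t" if "x \<ge> 0" for x using *[OF that] by auto
    then show ?thesis by (auto simp: not_less)
  qed
qed

lemma integrable_of_abs_powr:
  assumes "finite_measure M" "1 \<le> p" and [measurable]: "Y \<in> borel_measurable M"
    and int: "integrable M (\<lambda>\<omega>. \<bar>Y \<omega>\<bar> powr p :: real)"
  shows "integrable M (\<lambda>\<omega>. Y \<omega> :: real)"
proof -
  interpret finite_measure M by fact
  have "integrable M (\<lambda>\<omega>. 1 + \<bar>Y \<omega>\<bar> powr p)" using int by simp
  then show ?thesis
  proof (rule Bochner_Integration.integrable_bound)
    have "\<bar>y\<bar> \<le> 1 + \<bar>y\<bar> powr p" for y :: real
    proof (cases "\<bar>y\<bar> \<le> 1")
      case False
      then have "\<bar>y\<bar> powr 1 \<le> \<bar>y\<bar> powr p" using assms(2) by (intro powr_mono) auto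
      then show ?thesis using False by simp
    qed (smt (verit) powr_ge_zero)
    then show "AE \<omega> in M. norm (Y \<omega>) \<le> norm (1 + \<bar>Y \<omega>\<bar> powr p)" by (intro AE_I2) simp
  qed simp
qed

text \<open>For \<open>m = min \<bar>Y\<bar> a\<close> and \<open>p < 2\<close> one has \<open>a\<^bsup>p-2\<^esup> m\<^sup>2 \<le> m\<^sup>p \<le> \<bar>Y\<bar>\<^sup>p\<close>, an integrable majorant, while for
fixed \<open>Y\<close> the left side is at most \<open>a\<^bsup>p-2\<^esup> Y\<^sup>2\<close> and tends to zero.\<close>

lemma (in prob_space) truncated_second_moment_vanishes:
  fixes Y :: "'a \<Rightarrow> real" and a :: "nat \<Rightarrow> real"
  assumes "0 < p" "p < 2" and [measurable]: "Y \<in> borel_measurable M"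
    and Yp: "integrable M (\<lambda>\<omega>. \<bar>Y \<omega>\<bar> powr p)"
    and a: "\<And>n. a n \<ge> 0" "filterlim a at_top sequentially"
  shows "(\<lambda>n. a n powr (p - 2) * expectation (\<lambda>\<omega>. (min \<bar>Y \<omega>\<bar> (a n))\<^sup>2)) \<longlonglongrightarrow> 0"
proof -
  define f where "f n \<omega> = a n powr (p - 2) * (min \<bar>Y \<omega>\<bar> (a n))\<^sup>2" for n \<omega>
  have [measurable]: "f n \<in> borel_measurable M" for n
    unfolding f_def[abs_def] by measurable
  have pow0: "(\<lambda>n. a n powr (p - 2)) \<longlonglongrightarrow> 0"
    using \<open>p < 2\<close> by (intro tendsto_neg_powr a(2)) simp
  have "(\<lambda>n. expectation (f n)) \<longlonglongrightarrow> expectation (\<lambda>\<omega>. 0)"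
  proof (rule integral_dominated_convergence[where w = "\<lambda>\<omega>. \<bar>Y \<omega>\<bar> powr p"])
    show "AE \<omega> in M. (\<lambda>n. f n \<omega>) \<longlonglongrightarrow> 0"
    proof (rule AE_I2)
      fix \<omega>
      have upper: "(\<lambda>n. a n powr (p - 2) * \<bar>Y \<omega>\<bar>\<^sup>2) \<longlonglongrightarrow> 0"
        by (rule tendsto_mult_left_zero[OF pow0])
      show "(\<lambda>n. f n \<omega>) \<longlonglongrightarrow> 0"
      proof (rule tendsto_sandwich[OF _ _ tendsto_const upper])
        have "(min \<bar>Y \<omega>\<bar> (a n))\<^sup>2 \<le> \<bar>Y \<omega>\<bar>\<^sup>2" for n
          by (rule power_mono) (simp_all add: a(1))
        then show "\<forall>\<^sub>F n in sequentially. f n \<omega> \<le> a n powr (p - 2) * \<bar>Y \<omega>\<bar>\<^sup>2"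
          by (intro eventuallyI) (simp only: f_def mult_left_mono powr_ge_zero)
      qed (simp add: f_def)
    qed
    show "AE \<omega> in M. norm (f n \<omega>) \<le> \<bar>Y \<omega>\<bar> powr p" for n
    proof (rule AE_I2)
      fix \<omega>
      define m where "m = min \<bar>Y \<omega>\<bar> (a n)"
      show "norm (f n \<omega>) \<le> \<bar>Y \<omega>\<bar> powr p"
      proof (cases "m > 0")
        case True
        have "a n powr (p - 2) * m\<^sup>2 \<le> m powr (p - 2) * m\<^sup>2"
          using True \<open>p < 2\<close> by (intro mult_right_mono powr_mono2') (auto simp: m_def)
        also have "\<dots> = m powr p" using True by (simp add: powr_diff powr_numeral)
        also have "\<dots> \<le> \<bar>Y \<omega>\<bar> powr p" using True \<open>0 < p\<close> by (intro powr_mono2) (auto simp: m_def)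
        finally show ?thesis by (simp add: f_def m_def)
      next
        case False
        then have "m = 0" using a(1)[of n] by (auto simp: m_def min_def split: if_splits)
        then show ?thesis by (simp add: f_def m_def)
      qed
    qed
  qed (use Yp in auto)
  then show ?thesis by (simp add: f_def[abs_def])
qed

section \<open>The part above the truncation level\<close>

lemma (in prob_space) bounded_expectation_sums_imp_vanishing:
  fixes W :: "nat \<Rightarrow> 'a \<Rightarrow> real"
  assumes int: "\<And>m. integrable M (W m)" and nonneg: "\<And>m \<omega>. W m \<omega> \<ge> 0"
    and bound: "\<And>N. (\<Sum>m<N. expectation (W m)) \<le> K"
  shows "AE \<omega> in M. (\<lambda>m. W m \<omega>) \<longlonglongrightarrow> 0" and "(\<lambda>m. expectation (W m)) \<longlonglongrightarrow> 0"
proof -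
  have "summable (\<lambda>m. expectation (W m))"
  proof (rule summableI_nonneg_bounded)
    show "0 \<le> expectation (W m)" for m by (simp add: nonneg)
  qed (rule bound)
  then show "(\<lambda>m. expectation (W m)) \<longlonglongrightarrow> 0" by (rule summable_LIMSEQ_zero)
  have [measurable]: "W m \<in> borel_measurable M" for m using int[of m] by simp
  have "(\<integral>\<^sup>+\<omega>. (\<Sum>m. ennreal (W m \<omega>)) \<partial>M) = (\<Sum>m. \<integral>\<^sup>+\<omega>. ennreal (W m \<omega>) \<partial>M)"
    by (rule nn_integral_suminf) simp
  also have "\<dots> = (\<Sum>m. ennreal (expectation (W m)))"
    by (intro suminf_cong nn_integral_eq_integral int) (simp add: nonneg)
  also have "\<dots> = ennreal (\<Sum>m. expectation (W m))"
    by (rule suminf_ennreal2) (simp_all add: nonneg \<open>summable _\<close>)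
  finally have "(\<integral>\<^sup>+\<omega>. (\<Sum>m. ennreal (W m \<omega>)) \<partial>M) \<noteq> \<infinity>" by simp
  then have "AE \<omega> in M. (\<Sum>m. ennreal (W m \<omega>)) \<noteq> \<infinity>"
    by (intro nn_integral_noteq_infinite) simp_all
  then show "AE \<omega> in M. (\<lambda>m. W m \<omega>) \<longlonglongrightarrow> 0"
    by eventually_elim
       (auto intro!: summable_LIMSEQ_zero summable_suminf_not_top simp: nonneg)
qed

lemma tendsto_0_by_dyadic_domination:
  fixes T W :: "nat \<Rightarrow> real"
  assumes W: "W \<longlonglongrightarrow> 0" and T: "\<And>n. 0 \<le> T n"
    and TW: "\<And>m n. 2 ^ m \<le> n \<Longrightarrow> n < 2 ^ Suc m \<Longrightarrow> T n \<le> W m"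
  shows "T \<longlonglongrightarrow> 0"
proof (rule tendstoI)
  fix e :: real assume "e > 0"
  from order_tendstoD(2)[OF W this] obtain m0 where m0: "\<And>m. m \<ge> m0 \<Longrightarrow> W m < e"
    by (auto simp: eventually_sequentially)
  have "T n < e" if n: "n \<ge> 2 ^ m0" for n
  proof -
    have "n \<ge> 1" using n by (meson one_le_numeral one_le_power order_trans)
    then obtain m where m: "2 ^ m \<le> n" "n < 2 ^ Suc m"
      using ex_power_ivl1[of 2 n] by auto
    have "2 ^ m0 < (2::nat) ^ Suc m" using n m(2) by (rule le_less_trans)
    then have "m0 \<le> m" by (simp del: power_Suc)
    then show ?thesis using TW[OF m] m0[of m] by simp
  qed
  then show "\<forall>\<^sub>F n in sequentially. dist (T n) 0 < e"
    using T unfolding eventually_sequentially by (auto simp: abs_of_nonneg)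
qed

text \<open>First moments add up whatever the joint distribution is, and over the dyadic blocks they are
summable by \<open>dyadic_excess_sum_le\<close>. Both the almost sure limit and the limit of the expectations
are needed later, because the variables in the strong law are centered.\<close>

lemma (in prob_space) normalized_excess_vanishes:
  fixes X :: "nat \<Rightarrow> 'a \<Rightarrow> real" and Y :: "'a \<Rightarrow> real"
  assumes "p > 1"
    and X: "\<And>k. k \<ge> 1 \<Longrightarrow> X k \<in> borel_measurable M" and Y: "Y \<in> borel_measurable M"
    and "C \<ge> 0"
    and dom: "\<And>k t. k \<ge> 1 \<Longrightarrow> t > 0 \<Longrightarrow> \<P>(\<omega> in M. \<bar>X k \<omega>\<bar> > t) \<le> C * \<P>(\<omega> in M. \<bar>Y \<omega>\<bar> > t)"
    and Yp: "integrable M (\<lambda>\<omega>. \<bar>Y \<omega>\<bar> powr p)"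
  defines "T \<equiv> \<lambda>n \<omega>. (\<Sum>k=1..n. max 0 (\<bar>X k \<omega>\<bar> - level p n)) / (level p n * Log (real n))"
  shows "AE \<omega> in M. (\<lambda>n. T n \<omega>) \<longlonglongrightarrow> 0" and "(\<lambda>n. expectation (T n)) \<longlonglongrightarrow> 0"
    and "integrable M (T n)"
proof -
  note [measurable] = Y
  have intY: "integrable M (\<lambda>\<omega>. max 0 (\<bar>Y \<omega>\<bar> - a))" for a
    using integrable_of_abs_powr[OF finite_measure_axioms _ Y Yp] \<open>p > 1\<close> by auto
  have X_excess: "integrable M (\<lambda>\<omega>. max 0 (\<bar>X k \<omega>\<bar> - a))"
    "expectation (\<lambda>\<omega>. max 0 (\<bar>X k \<omega>\<bar> - a)) \<le> C * expectation (\<lambda>\<omega>. max 0 (\<bar>Y \<omega>\<bar> - a))"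
    if "k \<ge> 1" "a \<ge> 0" for k a
    by (rule dominated_integral_le[where g = "\<lambda>x. max 0 (x - a)", OF X[OF that(1)] Y _ \<open>C \<ge> 0\<close> dom[OF that(1)]
          disjI1[OF excess_levels[OF _ that(2)]] _ intY]; simp)+
  show intT: "integrable M (T n)" for n
    unfolding T_def using X_excess(1) level_nonneg[of p] by (intro integrable_divide integrable_sum) auto
  define b where "b n = level p n * Log (real n)" for n
  have b_pos: "b n > 0" if "n \<ge> 1" for n
    using level_pos[OF that, of p] Log_ge_1[of "real n"] by (simp add: b_def)
  have b_mono: "b m \<le> b n" if "m \<le> n" for m n
    unfolding b_def using that \<open>p > 1\<close> level_nonneg[of p] Log_ge_1[of "real m"]
    by (intro mult_mono level_mono Log_mono) auto
  define W where "W m \<omega> = (\<Sum>k=1..2 ^ Suc m. max 0 (\<bar>X k \<omega>\<bar> - level p (2 ^ m))) / b (2 ^ m)" for m \<omega>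
  have intW: "integrable M (W m)" for m
    unfolding W_def using X_excess(1) level_nonneg[of p] by (intro integrable_divide integrable_sum) auto
  have W_nonneg: "W m \<omega> \<ge> 0" for m \<omega>
    unfolding W_def using b_pos[of "2 ^ m"] by (intro divide_nonneg_pos sum_nonneg) auto
  have T_nonneg: "T n \<omega> \<ge> 0" for n \<omega>
    unfolding T_def using level_nonneg[of p n] Log_ge_1[of "real n"]
    by (intro divide_nonneg_nonneg sum_nonneg mult_nonneg_nonneg) auto
  have TW: "T n \<omega> \<le> W m \<omega>" if n: "2 ^ m \<le> n" "n < 2 ^ Suc m" for m n \<omega>
    unfolding T_def W_def b_def[of n, symmetric]
  proof (rule frac_le)
    have "(\<Sum>k=1..n. max 0 (\<bar>X k \<omega>\<bar> - level p n)) \<le> (\<Sum>k=1..n. max 0 (\<bar>X k \<omega>\<bar> - level p (2 ^ m)))"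
      using level_mono[OF _ n(1), of p] \<open>p > 1\<close> by (intro sum_mono max.mono) auto
    also have "\<dots> \<le> (\<Sum>k=1..2 ^ Suc m. max 0 (\<bar>X k \<omega>\<bar> - level p (2 ^ m)))"
      using n(2) by (intro sum_mono2) auto
    finally show "(\<Sum>k=1..n. max 0 (\<bar>X k \<omega>\<bar> - level p n)) \<le>
      (\<Sum>k=1..2 ^ Suc m. max 0 (\<bar>X k \<omega>\<bar> - level p (2 ^ m)))" .
  qed (use b_pos[of "2 ^ m"] b_mono[OF n(1)] in \<open>auto intro: sum_nonneg\<close>)
  define q where "q = (2 / (1 + ln 2)) powr ((p - 1) / p)"
  define e where "e m = expectation (\<lambda>\<omega>. max 0 (\<bar>Y \<omega>\<bar> - level p (2 ^ m)))" for m
  have EW: "expectation (W m) \<le> 2 * C * (level p (2 ^ m) powr (p - 1) * e m)" for m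
  proof -
    have "expectation (W m) = (\<Sum>k=1..2 ^ Suc m. expectation (\<lambda>\<omega>. max 0 (\<bar>X k \<omega>\<bar> - level p (2 ^ m)))) / b (2 ^ m)"
      unfolding W_def using X_excess(1) level_nonneg[of p] by simp
    also have "\<dots> \<le> (\<Sum>k=1..(2::nat) ^ Suc m. C * e m) / b (2 ^ m)"
      unfolding e_def using X_excess(2) level_nonneg[of p] b_pos[of "2 ^ m"]
      by (intro divide_right_mono sum_mono) auto
    also have "\<dots> = 2 * C * (real (2 ^ m) / b (2 ^ m) * e m)" by simp
    also have "real (2 ^ m) / b (2 ^ m) = level p (2 ^ m) powr (p - 1)"
      using level_powr_minus_1[of p "2 ^ m"] \<open>p > 1\<close> by (simp add: b_def)
    finally show ?thesis .
  qed
  have "(\<Sum>m<N. expectation (W m)) \<le> 2 * C * (q / (q - 1) * expectation (\<lambda>\<omega>. \<bar>Y \<omega>\<bar> powr p))" for N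
  proof -
    have "(\<Sum>m<N. expectation (W m)) \<le> (\<Sum>m<N. 2 * C * (level p (2 ^ m) powr (p - 1) * e m))"
      by (intro sum_mono EW)
    also have "\<dots> = 2 * C * expectation (\<lambda>\<omega>. \<Sum>m<N. level p (2 ^ m) powr (p - 1) * max 0 (\<bar>Y \<omega>\<bar> - level p (2 ^ m)))"
      by (subst Bochner_Integration.integral_sum) (auto simp: e_def sum_distrib_left intY)
    also have "\<dots> \<le> 2 * C * expectation (\<lambda>\<omega>. q / (q - 1) * \<bar>Y \<omega>\<bar> powr p)"
      using dyadic_excess_sum_le[OF \<open>p > 1\<close>] \<open>C \<ge> 0\<close> Yp
      by (intro mult_left_mono integral_mono Bochner_Integration.integrable_sum integrable_mult_right intY)
         (auto simp: q_def)
    finally show ?thesis by simp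
  qed
  note W_lim = bounded_expectation_sums_imp_vanishing[OF intW W_nonneg this]
  show "AE \<omega> in M. (\<lambda>n. T n \<omega>) \<longlonglongrightarrow> 0"
    using W_lim(1) by eventually_elim (rule tendsto_0_by_dyadic_domination[OF _ T_nonneg TW])
  show "(\<lambda>n. expectation (T n)) \<longlonglongrightarrow> 0"
    by (rule tendsto_0_by_dyadic_domination[OF W_lim(2)])
       (auto intro!: integral_mono intT intW TW simp: T_nonneg)
qed

section \<open>Almost sure convergence of the clipped sums\<close>

text \<open>The event on the left concerns strict inequalities \<open>X k < - x k\<close>, whereas the hypothesis is about
weak ones. The strict event is the increasing limit of the weak events with thresholds lowered
by \<open>1 / (j + 1)\<close>, and on the right each weak probability is at most the strict one.\<close>

lemma (in prob_space) lower_orthant_imp_upper_orthant_minus: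
  fixes X :: "nat \<Rightarrow> 'a \<Rightarrow> real" and B :: real
  assumes I: "finite I" and X: "\<And>k. k \<in> I \<Longrightarrow> X k \<in> borel_measurable M" and "B \<ge> 0"
    and orth: "\<And>x. \<P>(\<omega> in M. \<forall>k\<in>I. X k \<omega> \<le> x k) \<le> B * (\<Prod>k\<in>I. \<P>(\<omega> in M. X k \<omega> \<le> x k))"
  shows "\<P>(\<omega> in M. \<forall>k\<in>I. - X k \<omega> > x k) \<le> B * (\<Prod>k\<in>I. \<P>(\<omega> in M. - X k \<omega> > x k))"
proof -
  define A where "A j = {\<omega>\<in>space M. \<forall>k\<in>I. X k \<omega> \<le> - x k - 1 / real (Suc j)}" for j
  have "A j \<in> sets M" for j unfolding A_def using I X by measurable
  moreover have "incseq A"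
  proof (rule incseq_SucI)
    fix j
    have "1 / real (Suc (Suc j)) \<le> 1 / real (Suc j)" by (intro divide_left_mono) auto
    then show "A j \<subseteq> A (Suc j)" unfolding A_def by (fastforce intro: order_trans)
  qed
  ultimately have "(\<lambda>j. prob (A j)) \<longlonglongrightarrow> prob (\<Union>j. A j)"
    by (intro finite_Lim_measure_incseq) auto
  moreover have "(\<Union>j. A j) = {\<omega>\<in>space M. \<forall>k\<in>I. - X k \<omega> > x k}"
  proof (intro equalityI subsetI)
    fix \<omega> assume "\<omega> \<in> (\<Union>j. A j)"
    then obtain j where j: "\<omega> \<in> space M" "\<And>k. k \<in> I \<Longrightarrow> X k \<omega> \<le> - x k - 1 / real (Suc j)"
      by (auto simp: A_def)
    have "0 < 1 / real (Suc j)" by simp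
    then have "- X k \<omega> > x k" if "k \<in> I" for k using j(2)[OF that] by linarith
    then show "\<omega> \<in> {\<omega>\<in>space M. \<forall>k\<in>I. - X k \<omega> > x k}" using j(1) by simp
  next
    fix \<omega> assume w: "\<omega> \<in> {\<omega>\<in>space M. \<forall>k\<in>I. - X k \<omega> > x k}"
    have "\<forall>\<^sub>F j in sequentially. \<forall>k\<in>I. X k \<omega> \<le> - x k - 1 / real (Suc j)"
    proof (intro eventually_ball_finite[OF I] ballI)
      fix k assume "k \<in> I"
      then have "0 < - x k - X k \<omega>" using w by auto
      from order_tendstoD(2)[OF LIMSEQ_inverse_real_of_nat this]
      show "\<forall>\<^sub>F j in sequentially. X k \<omega> \<le> - x k - 1 / real (Suc j)"
        by eventually_elim (simp add: inverse_eq_divide)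
    qed
    then show "\<omega> \<in> (\<Union>j. A j)"
      using w by (auto simp: A_def eventually_sequentially)
  qed
  moreover have "prob (A j) \<le> B * (\<Prod>k\<in>I. \<P>(\<omega> in M. - X k \<omega> > x k))" for j
  proof -
    have pos: "0 < 1 / real (Suc j)" by simp
    have "prob (A j) \<le> B * (\<Prod>k\<in>I. \<P>(\<omega> in M. X k \<omega> \<le> - x k - 1 / real (Suc j)))"
      unfolding A_def by (rule orth)
    also have "\<dots> \<le> B * (\<Prod>k\<in>I. \<P>(\<omega> in M. - X k \<omega> > x k))"
    proof (intro mult_left_mono prod_mono conjI)
      fix k assume "k \<in> I"
      then have [measurable]: "X k \<in> borel_measurable M" by (rule X)
      show "\<P>(\<omega> in M. X k \<omega> \<le> - x k - 1 / real (Suc j)) \<le> \<P>(\<omega> in M. - X k \<omega> > x k)"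
      proof (rule finite_measure_mono)
        show "{\<omega>\<in>space M. X k \<omega> \<le> - x k - 1 / real (Suc j)} \<subseteq> {\<omega>\<in>space M. - X k \<omega> > x k}"
          using pos by (intro Collect_mono) linarith
      qed measurable
    qed (use \<open>B \<ge> 0\<close> in auto)
    finally show ?thesis .
  qed
  ultimately show ?thesis by (metis (no_types, lifting) LIMSEQ_le_const2)
qed

text \<open>The Chernoff bound is used with \<open>\<theta> = K / a n\<close>. This makes the exponents bounded by \<open>2 K C\<close>, turns the
second-moment term into \<open>\<eta> n * Log n\<close> with \<open>\<eta> n\<close> tending to zero, and makes the gain equal to
\<open>K \<delta> Log n\<close>. A power of \<open>n\<close> in front is thus beaten by taking \<open>K\<close> large.\<close>

lemma (in prob_space) orthant_clipped_sum_eventually_less: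
  fixes Z :: "nat \<Rightarrow> 'a \<Rightarrow> real" and w :: "nat \<Rightarrow> nat \<Rightarrow> real" and B a v :: "nat \<Rightarrow> real"
  assumes Z: "\<And>k. k \<ge> 1 \<Longrightarrow> Z k \<in> borel_measurable M"
    and orth: "\<And>n x. n \<ge> 1 \<Longrightarrow> \<P>(\<omega> in M. \<forall>k\<in>{1..n}. Z k \<omega> > x k) \<le>
        B n * (\<Prod>k=1..n. \<P>(\<omega> in M. Z k \<omega> > x k))"
    and B: "\<And>n. n \<ge> 1 \<Longrightarrow> B n \<ge> 0" "B \<in> O(\<lambda>n. real n powr \<alpha>)" and "\<alpha> > 0"
    and a: "\<And>n. n \<ge> 1 \<Longrightarrow> a n > 0"
    and w: "\<forall>\<^sub>F n in sequentially. \<forall>k\<in>{1..n}. 0 \<le> w n k \<and> w n k \<le> C"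
    and v: "\<And>n k. n \<ge> 1 \<Longrightarrow> k \<in> {1..n} \<Longrightarrow> expectation (\<lambda>\<omega>. (clip (a n) (Z k \<omega>))\<^sup>2) \<le> v n"
    and lim: "(\<lambda>n. real n * v n / ((a n)\<^sup>2 * Log (real n))) \<longlonglongrightarrow> 0"
    and "\<delta> > 0"
  shows "AE \<omega> in M. \<forall>\<^sub>F n in sequentially.
    (\<Sum>k=1..n. w n k * (clip (a n) (Z k \<omega>) - expectation (\<lambda>\<omega>. clip (a n) (Z k \<omega>)))) <
      \<delta> * (a n * Log (real n))"
proof -
  define S where "S n \<omega> =
    (\<Sum>k=1..n. w n k * (clip (a n) (Z k \<omega>) - expectation (\<lambda>\<omega>. clip (a n) (Z k \<omega>))))" for n \<omega>
  define E where "E n = {\<omega>\<in>space M. \<delta> * (a n * Log (real n)) \<le> S n \<omega>}" for n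
  \<comment> \<open>This leaves a bound of order \<open>n powr (- 2)\<close>: of the exponent \<open>\<alpha> + 3\<close>, the part \<open>\<alpha>\<close> cancels the growth of \<open>B\<close> and 1 absorbs \<open>\<eta>\<close>.\<close>
  define K where "K = (\<alpha> + 3) / \<delta>"
  have K: "K > 0" "K * \<delta> = \<alpha> + 3" using \<open>\<alpha> > 0\<close> \<open>\<delta> > 0\<close> by (simp_all add: K_def)
  define \<eta> where "\<eta> n = exp (2 * K * C) * (K * C)\<^sup>2 * (real n * v n / ((a n)\<^sup>2 * Log (real n)))" for n
  have "\<eta> \<longlonglongrightarrow> 0" unfolding \<eta>_def by (rule tendsto_mult_right_zero[OF lim])
  then have \<eta>: "\<forall>\<^sub>F n in sequentially. \<eta> n < 1" by (rule order_tendstoD) simp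
  obtain c where c: "c > 0" "\<forall>\<^sub>F n in sequentially. norm (B n) \<le> c * norm (real n powr \<alpha>)"
    using B(2) by (elim landau_o.bigE)
  have Sm: "S n \<in> borel_measurable M" for n
    unfolding S_def
  proof (rule borel_measurable_sum)
    fix k assume "k \<in> {1..n}"
    then have [measurable]: "Z k \<in> borel_measurable M" by (intro Z) simp
    show "(\<lambda>\<omega>. w n k * (clip (a n) (Z k \<omega>) - expectation (\<lambda>\<omega>. clip (a n) (Z k \<omega>)))) \<in> borel_measurable M"
      by measurable
  qed
  have Em: "E n \<in> sets M" for n
    unfolding E_def using Sm[of n] by measurable
  have "\<forall>\<^sub>F n in sequentially. norm (prob (E n)) \<le> c * real n powr (- 2)"
    using w \<eta> c(2) eventually_ge_at_top[of 3]
  proof eventually_elim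
    case (elim n)
    then have n: "n \<ge> 1" "Log (real n) = ln (real n)" and L: "Log (real n) > 0" "ln (real n) > 0"
      using Log_ge_1[of "real n"] by (auto simp: Log_eq_ln)
    have an: "a n > 0" using a n by auto
    have "prob (E n) \<le> B n * exp (real (card {1..n}) * (exp (2 * (K / a n * C) * a n) * (K / a n * C)\<^sup>2 * v n) -
        K / a n * (\<delta> * (a n * Log (real n))))"
      unfolding E_def S_def
      by (rule orthant_clipped_sum_tail) (use elim n Z orth B(1) an K v in auto)
    also have "real (card {1..n}) * (exp (2 * (K / a n * C) * a n) * (K / a n * C)\<^sup>2 * v n) -
        K / a n * (\<delta> * (a n * Log (real n))) = (\<eta> n - K * \<delta>) * ln (real n)"
      using an L by (simp add: \<eta>_def n(2) field_simps power2_eq_square)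
    also have "B n * exp ((\<eta> n - K * \<delta>) * ln (real n)) \<le>
        (c * real n powr \<alpha>) * exp ((- \<alpha> - 2) * ln (real n))"
      using elim L K(2) c(1)
      by (intro mult_mono iffD2[OF exp_le_cancel_iff] mult_right_mono) (auto intro: order_trans[OF abs_ge_self])
    also have "exp ((- \<alpha> - 2) * ln (real n)) = real n powr (- \<alpha> - 2)"
      using n by (simp add: powr_def)
    also have "(c * real n powr \<alpha>) * real n powr (- \<alpha> - 2) = c * real n powr (- 2)"
      by (simp add: mult.assoc flip: powr_add)
    finally show ?case by simp
  qed
  moreover have "summable (\<lambda>n. c * real n powr (- 2))"
    by (intro summable_mult) (simp add: summable_real_powr_iff)
  ultimately have "summable (\<lambda>n. prob (E n))"
    by (rule summable_comparison_test_ev)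
  then have "AE \<omega> in M. \<forall>\<^sub>F n in sequentially. \<omega> \<in> space M - E n"
    by (intro borel_cantelli_AE1 Em) (auto simp: emeasure_eq_measure)
  then show ?thesis
    by eventually_elim (auto elim!: eventually_mono simp: E_def S_def)
qed

text \<open>The one-sided bound is applied four times: to the positive and negative parts of the weights,
each with \<open>Z\<close> and with \<open>-Z\<close>. Clipping is odd, so the bounds for \<open>-Z\<close> are lower bounds for the same
sums.\<close>

lemma (in prob_space) orthant_clipped_sum_tendsto_0:
  fixes Z :: "nat \<Rightarrow> 'a \<Rightarrow> real" and c :: "nat \<Rightarrow> nat \<Rightarrow> real" and B a v :: "nat \<Rightarrow> real"
  assumes Z: "\<And>k. k \<ge> 1 \<Longrightarrow> Z k \<in> borel_measurable M"
    and upper: "\<And>n x. n \<ge> 1 \<Longrightarrow> \<P>(\<omega> in M. \<forall>k\<in>{1..n}. Z k \<omega> > x k) \<le>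
        B n * (\<Prod>k=1..n. \<P>(\<omega> in M. Z k \<omega> > x k))"
    and lower: "\<And>n x. n \<ge> 1 \<Longrightarrow> \<P>(\<omega> in M. \<forall>k\<in>{1..n}. Z k \<omega> \<le> x k) \<le>
        B n * (\<Prod>k=1..n. \<P>(\<omega> in M. Z k \<omega> \<le> x k))"
    and B: "\<And>n. n \<ge> 1 \<Longrightarrow> B n \<ge> 0" "B \<in> O(\<lambda>n. real n powr \<alpha>)" and "\<alpha> > 0"
    and a: "\<And>n. n \<ge> 1 \<Longrightarrow> a n > 0"
    and c: "\<forall>\<^sub>F n in sequentially. \<forall>k\<in>{1..n}. \<bar>c n k\<bar> \<le> C"
    and v: "\<And>n k. n \<ge> 1 \<Longrightarrow> k \<in> {1..n} \<Longrightarrow> expectation (\<lambda>\<omega>. (clip (a n) (Z k \<omega>))\<^sup>2) \<le> v n"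
    and lim: "(\<lambda>n. real n * v n / ((a n)\<^sup>2 * Log (real n))) \<longlonglongrightarrow> 0"
  shows "AE \<omega> in M. (\<lambda>n.
    (\<Sum>k=1..n. c n k * (clip (a n) (Z k \<omega>) - expectation (\<lambda>\<omega>. clip (a n) (Z k \<omega>)))) /
      (a n * Log (real n))) \<longlonglongrightarrow> 0"
proof -
  define D where "D n k \<omega> = clip (a n) (Z k \<omega>) - expectation (\<lambda>\<omega>. clip (a n) (Z k \<omega>))" for n k \<omega>
  have D_minus: "clip (a n) (- Z k \<omega>) - expectation (\<lambda>\<omega>. clip (a n) (- Z k \<omega>)) = - D n k \<omega>"
    if "n \<ge> 1" for n k \<omega>
    using a[OF that] by (simp add: D_def clip_minus)
  define p where "p n k = max 0 (c n k)" for n k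
  define q where "q n k = max 0 (- c n k)" for n k
  have cpq: "c n k = p n k - q n k" for n k by (auto simp: p_def q_def)
  have pb: "\<forall>\<^sub>F n in sequentially. \<forall>k\<in>{1..n}. 0 \<le> p n k \<and> p n k \<le> C"
    and qb: "\<forall>\<^sub>F n in sequentially. \<forall>k\<in>{1..n}. 0 \<le> q n k \<and> q n k \<le> C"
    by (use c in eventually_elim, force simp: p_def q_def)+
  have upper': "\<P>(\<omega> in M. \<forall>k\<in>{1..n}. - Z k \<omega> > x k) \<le>
        B n * (\<Prod>k=1..n. \<P>(\<omega> in M. - Z k \<omega> > x k))" if "n \<ge> 1" for n x
    using Z lower[OF that] B(1)[OF that] by (intro lower_orthant_imp_upper_orthant_minus) auto
  have v': "expectation (\<lambda>\<omega>. (clip (a n) (- Z k \<omega>))\<^sup>2) \<le> v n" if "n \<ge> 1" "k \<in> {1..n}" for n k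
    using v[OF that] a[OF that(1)] by (simp add: clip_minus)
  have Z': "(\<lambda>\<omega>. - Z k \<omega>) \<in> borel_measurable M" if "k \<ge> 1" for k using Z[OF that] by simp
  have pos: "AE \<omega> in M. \<forall>\<^sub>F n in sequentially. (\<Sum>k=1..n. w n k * D n k \<omega>) < \<delta> * (a n * Log (real n))"
    if "\<forall>\<^sub>F n in sequentially. \<forall>k\<in>{1..n}. 0 \<le> w n k \<and> w n k \<le> C" "\<delta> > 0" for w \<delta>
    unfolding D_def
    by (rule orthant_clipped_sum_eventually_less[OF Z upper B \<open>\<alpha> > 0\<close> a that(1) v lim that(2)])
  have neg: "AE \<omega> in M. \<forall>\<^sub>F n in sequentially. - (\<Sum>k=1..n. w n k * D n k \<omega>) < \<delta> * (a n * Log (real n))"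
    if "\<forall>\<^sub>F n in sequentially. \<forall>k\<in>{1..n}. 0 \<le> w n k \<and> w n k \<le> C" "\<delta> > 0" for w \<delta>
  proof -
    have "AE \<omega> in M. \<forall>\<^sub>F n in sequentially. (\<Sum>k=1..n. w n k *
        (clip (a n) (- Z k \<omega>) - expectation (\<lambda>\<omega>. clip (a n) (- Z k \<omega>)))) < \<delta> * (a n * Log (real n))"
      by (rule orthant_clipped_sum_eventually_less[OF Z' upper' B \<open>\<alpha> > 0\<close> a that(1) v' lim that(2)])
    then show ?thesis
    proof eventually_elim
      case (elim \<omega>)
      then show ?case using eventually_ge_at_top[of 1]
        by eventually_elim (simp add: D_minus sum_negf)
    qed
  qed
  have "AE \<omega> in M. \<forall>j. \<forall>\<^sub>F n in sequentially.
    \<bar>(\<Sum>k=1..n. c n k * D n k \<omega>) / (a n * Log (real n))\<bar> < 2 * inverse (real (Suc j))"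
  proof (subst AE_all_countable, intro allI)
    fix j
    define \<delta> where "\<delta> = inverse (real (Suc j))"
    have "\<delta> > 0" by (simp add: \<delta>_def)
    show "AE \<omega> in M. \<forall>\<^sub>F n in sequentially.
      \<bar>(\<Sum>k=1..n. c n k * D n k \<omega>) / (a n * Log (real n))\<bar> < 2 * inverse (real (Suc j))"
      using pos[OF pb \<open>\<delta> > 0\<close>] pos[OF qb \<open>\<delta> > 0\<close>] neg[OF pb \<open>\<delta> > 0\<close>] neg[OF qb \<open>\<delta> > 0\<close>]
    proof eventually_elim
      case (elim \<omega>)
      show ?case
        using elim eventually_ge_at_top[of 1]
      proof eventually_elim
        case (elim n)
        have b: "a n * Log (real n) > 0"
          using a[OF elim(5)] Log_ge_1[of "real n"] by simp
        have "(\<Sum>k=1..n. c n k * D n k \<omega>) = (\<Sum>k=1..n. p n k * D n k \<omega>) - (\<Sum>k=1..n. q n k * D n k \<omega>)"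
          by (simp add: cpq left_diff_distrib sum_subtractf)
        then have "\<bar>\<Sum>k=1..n. c n k * D n k \<omega>\<bar> < 2 * \<delta> * (a n * Log (real n))"
          using elim(1-4) by linarith
        then show ?case using b
          by (simp add: abs_divide abs_of_pos pos_divide_less_eq \<delta>_def)
      qed
    qed
  qed
  then show ?thesis
  proof eventually_elim
    case (elim \<omega>)
    show ?case
    proof (rule tendstoI)
      fix e :: real assume "e > 0"
      then obtain j where "inverse (real (Suc j)) < e / 2" using reals_Archimedean[of "e / 2"] by auto
      then show "\<forall>\<^sub>F n in sequentially. dist ((\<Sum>k=1..n. c n k *
          (clip (a n) (Z k \<omega>) - expectation (\<lambda>\<omega>. clip (a n) (Z k \<omega>)))) / (a n * Log (real n))) 0 < e"
        using elim[THEN spec, of j] unfolding D_def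
        by (auto elim!: eventually_mono)
    qed
  qed
qed

section \<open>The strong law\<close>

theorem theorem2:
  fixes P :: "'a measure"
    and X :: "nat \<Rightarrow> 'a \<Rightarrow> real"
    and Y :: "'a \<Rightarrow> real"
    and M :: "nat \<Rightarrow> real"
    and c :: "nat \<Rightarrow> nat \<Rightarrow> real"
    and p \<alpha> :: real
  assumes "prob_space P"
    and "1 < p" and "p < 2"
    and "\<And>n. n \<ge> 1 \<Longrightarrow> X n \<in> borel_measurable P"
    and "widely_orthant_dependent P X M"
    and "\<alpha> > 0" and "M \<in> O(\<lambda>n. real n powr \<alpha>)"
    and "Y \<in> borel_measurable P"
    and "stochastically_dominated P X Y"
    and "integrable P (\<lambda>\<omega>. \<bar>Y \<omega>\<bar> powr p)"
    and "(\<lambda>n. MAX k\<in>{1..n}. \<bar>c n k\<bar>) \<in> O(\<lambda>n. 1)"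
  shows "AE \<omega> in P.
    (\<lambda>n. 1 / (real n powr (1 / p) * Log (real n) powr (1 - 1 / p)) *
         (\<Sum>k=1..n. c n k * (X k \<omega> - prob_space.expectation P (X k)))) \<longlonglongrightarrow> 0"
proof -
  interpret prob_space P by fact
  note X = assms(4) and Y = assms(8) and Yp = assms(10)
  note [measurable] = Y
  obtain D where D: "D > 0" and
    dom: "\<And>n t. n \<ge> 1 \<Longrightarrow> t > 0 \<Longrightarrow> \<P>(\<omega> in P. \<bar>X n \<omega>\<bar> > t) \<le> D * \<P>(\<omega> in P. \<bar>Y \<omega>\<bar> > t)"
    using assms(9) unfolding stochastically_dominated_def by blast
  obtain C where C: "C > 0" and "\<forall>\<^sub>F n in sequentially. norm (MAX k\<in>{1..n}. \<bar>c n k\<bar>) \<le> C * norm (1::real)"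
    using assms(11) by (elim landau_o.bigE)
  then have c: "\<forall>\<^sub>F n in sequentially. \<forall>k\<in>{1..n}. \<bar>c n k\<bar> \<le> C"
  proof (elim eventually_mono, intro ballI)
    fix n k assume n: "norm (MAX k\<in>{1..n}. \<bar>c n k\<bar>) \<le> C * norm (1::real)" and k: "k \<in> {1..n}"
    have "\<bar>c n k\<bar> \<le> (MAX k\<in>{1..n}. \<bar>c n k\<bar>)" using k by (intro Max_ge) auto
    then show "\<bar>c n k\<bar> \<le> C" using n by simp
  qed
  define a where "a = level p"
  have a_pos: "a n > 0" if "n \<ge> 1" for n using level_pos[OF that] by (simp add: a_def)
  have a_nonneg: "a n \<ge> 0" for n by (simp add: a_def level_nonneg)
  define v where "v n = D * expectation (\<lambda>\<omega>. (min \<bar>Y \<omega>\<bar> (a n))\<^sup>2)" for n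
  have v: "expectation (\<lambda>\<omega>. (clip (a n) (X k \<omega>))\<^sup>2) \<le> v n" if "k \<in> {1..n}" for n k
  proof -
    have "k \<ge> 1" using that by simp
    have "integrable P (\<lambda>\<omega>. (min \<bar>Y \<omega>\<bar> (a n))\<^sup>2)"
    proof (rule integrable_const_bound[of _ "(a n)\<^sup>2"])
      show "AE \<omega> in P. norm ((min \<bar>Y \<omega>\<bar> (a n))\<^sup>2) \<le> (a n)\<^sup>2"
        using a_nonneg[of n] by (intro AE_I2) (simp add: power_mono)
    qed simp
    then have "expectation (\<lambda>\<omega>. (min \<bar>X k \<omega>\<bar> (a n))\<^sup>2) \<le> v n"
      unfolding v_def
      by (intro dominated_integral_le(2)[where g = "\<lambda>x. (min x (a n))\<^sup>2", OF X[OF \<open>k \<ge> 1\<close>] Y _ _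
            dom[OF \<open>k \<ge> 1\<close>] clipped_square_levels[OF _ a_nonneg]]) (use D in auto)
    then show ?thesis using abs_clip[OF a_nonneg] by (metis (no_types, lifting) Bochner_Integration.integral_cong power2_abs)
  qed
  have "(\<lambda>n. real n * v n / ((a n)\<^sup>2 * Log (real n))) \<longlonglongrightarrow> 0"
  proof -
    have "(\<lambda>n. D * (a n powr (p - 2) * expectation (\<lambda>\<omega>. (min \<bar>Y \<omega>\<bar> (a n))\<^sup>2))) \<longlonglongrightarrow> 0"
      using \<open>1 < p\<close> \<open>p < 2\<close> Yp level_at_top[of p]
      by (intro tendsto_mult_right_zero truncated_second_moment_vanishes a_nonneg) (auto simp: a_def)
    then show ?thesis
    proof (rule Lim_transform_eventually)
      show "\<forall>\<^sub>F n in sequentially. D * (a n powr (p - 2) * expectation (\<lambda>\<omega>. (min \<bar>Y \<omega>\<bar> (a n))\<^sup>2)) =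
        real n * v n / ((a n)\<^sup>2 * Log (real n))"
        using eventually_ge_at_top[of 1]
      proof eventually_elim
        case (elim n)
        have "a n powr (p - 2) = real n / Log (real n) / (a n)\<^sup>2"
          using a_pos[OF elim] level_powr[OF _ elim, of p] \<open>1 < p\<close>
          by (simp add: powr_diff powr_numeral a_def)
        then show ?case by (simp add: v_def mult_ac)
      qed
    qed
  qed
  then have clipped: "AE \<omega> in P. (\<lambda>n.
    (\<Sum>k=1..n. c n k * (clip (a n) (X k \<omega>) - expectation (\<lambda>\<omega>. clip (a n) (X k \<omega>)))) /
      (a n * Log (real n))) \<longlonglongrightarrow> 0"
    using assms(5) v
    by (intro orthant_clipped_sum_tendsto_0[OF X _ _ _ assms(7,6) a_pos c])
       (auto simp: widely_orthant_dependent_def intro: less_imp_le)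
  define T where "T n \<omega> = (\<Sum>k=1..n. max 0 (\<bar>X k \<omega>\<bar> - a n)) / (a n * Log (real n))" for n \<omega>
  have T: "AE \<omega> in P. (\<lambda>n. T n \<omega>) \<longlonglongrightarrow> 0" "(\<lambda>n. expectation (T n)) \<longlonglongrightarrow> 0" "integrable P (T n)" for n
    using normalized_excess_vanishes[OF \<open>1 < p\<close> X Y less_imp_le[OF D] dom Yp]
    unfolding T_def a_def by auto
  have intY: "integrable P Y" using integrable_of_abs_powr[OF finite_measure_axioms _ Y Yp] \<open>1 < p\<close> by simp
  have intX: "integrable P (X k)" if "k \<ge> 1" for k
  proof -
    have [measurable]: "X k \<in> borel_measurable P" using X[OF that] .
    \<comment> \<open>The excess over level zero is the absolute value.\<close>
    have "integrable P (\<lambda>\<omega>. max 0 (\<bar>X k \<omega>\<bar> - 0))"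
      by (rule dominated_integral_le[where g = "\<lambda>x. max 0 (x - 0)", OF X[OF that] Y _ less_imp_le[OF D] dom[OF that]
          disjI1[OF excess_levels[OF _ order_refl]]]) (use intY in auto)
    then show ?thesis by (simp add: integrable_abs_iff)
  qed
  show ?thesis
    using clipped T(1)
  proof eventually_elim
    case (elim \<omega>)
    define S where "S n = (\<Sum>k=1..n. c n k * (clip (a n) (X k \<omega>) - expectation (\<lambda>\<omega>. clip (a n) (X k \<omega>)))) /
      (a n * Log (real n))" for n
    define F where "F n = 1 / (real n powr (1 / p) * Log (real n) powr (1 - 1 / p)) *
         (\<Sum>k=1..n. c n k * (X k \<omega> - expectation (X k)))" for n
    have S: "S \<longlonglongrightarrow> 0" unfolding S_def by (rule elim(1))
    have "(\<lambda>n. F n - S n) \<longlonglongrightarrow> 0"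
    proof (rule Lim_null_comparison)
      show "(\<lambda>n. C * (T n \<omega> + expectation (T n))) \<longlonglongrightarrow> 0"
        by (intro tendsto_mult_right_zero tendsto_add_zero elim(2) T(2))
      show "\<forall>\<^sub>F n in sequentially. norm (F n - S n) \<le> C * (T n \<omega> + expectation (T n))"
        using c eventually_ge_at_top[of 1]
      proof eventually_elim
        case (elim n)
        define b where "b = a n * Log (real n)"
        have b: "b > 0" using a_pos[OF elim(2)] Log_ge_1[of "real n"] by (simp add: b_def)
        define r where "r k \<omega> = X k \<omega> - clip (a n) (X k \<omega>)" for k \<omega>
        have abs_r: "\<bar>r k \<omega>\<bar> = max 0 (\<bar>X k \<omega>\<bar> - a n)" for k \<omega>
          unfolding r_def by (rule abs_diff_clip[OF a_nonneg])
        have intc: "integrable P (\<lambda>\<omega>. clip (a n) (X k \<omega>))" if "k \<ge> 1" for k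
        proof (rule integrable_const_bound[of _ "a n"])
          show "AE \<omega> in P. norm (clip (a n) (X k \<omega>)) \<le> a n"
            using abs_clip[OF a_nonneg] by (intro AE_I2) simp
          show "(\<lambda>\<omega>. clip (a n) (X k \<omega>)) \<in> borel_measurable P"
            using X[OF that] by measurable
        qed
        have intr: "integrable P (r k)" if "k \<ge> 1" for k
          unfolding r_def using intX[OF that] intc[OF that] by simp
        have Er: "expectation (r k) = expectation (X k) - expectation (\<lambda>\<omega>. clip (a n) (X k \<omega>))" if "k \<ge> 1" for k
          unfolding r_def using intX[OF that] intc[OF that] by simp
        have "F n - S n = (\<Sum>k=1..n. c n k * (r k \<omega> - expectation (r k))) / b"
        proof -
          have "(\<Sum>k=1..n. c n k * (r k \<omega> - expectation (r k))) =
              (\<Sum>k=1..n. c n k * (X k \<omega> - expectation (X k)) -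
                 c n k * (clip (a n) (X k \<omega>) - expectation (\<lambda>\<omega>. clip (a n) (X k \<omega>))))"
            by (intro sum.cong) (auto simp: Er r_def algebra_simps)
          then show ?thesis
            by (simp add: F_def S_def b_def a_def level_mult_Log sum_subtractf diff_divide_distrib)
        qed
        also have "norm \<dots> = \<bar>\<Sum>k=1..n. c n k * (r k \<omega> - expectation (r k))\<bar> / b"
          using b by simp
        also have "\<dots> \<le> (\<Sum>k=1..n. C * (\<bar>r k \<omega>\<bar> + expectation (\<lambda>\<omega>. \<bar>r k \<omega>\<bar>))) / b"
        proof (intro divide_right_mono order_trans[OF sum_abs] sum_mono)
          fix k assume k: "k \<in> {1..n}"
          have "\<bar>r k \<omega> - expectation (r k)\<bar> \<le> \<bar>r k \<omega>\<bar> + expectation (\<lambda>\<omega>. \<bar>r k \<omega>\<bar>)"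
            using integral_abs_bound[of P "r k"] by linarith
          then show "\<bar>c n k * (r k \<omega> - expectation (r k))\<bar> \<le> C * (\<bar>r k \<omega>\<bar> + expectation (\<lambda>\<omega>. \<bar>r k \<omega>\<bar>))"
            using elim(1) k C by (auto simp: abs_mult intro!: mult_mono)
        qed (use b in simp)
        also have "\<dots> = C * (T n \<omega> + expectation (T n))"
        proof -
          have "expectation (T n) = (\<Sum>k=1..n. expectation (\<lambda>\<omega>. \<bar>r k \<omega>\<bar>)) / b"
            unfolding T_def abs_r[symmetric] b_def[symmetric] using intr by simp
          then show ?thesis
            by (simp add: T_def abs_r[symmetric] b_def[symmetric] sum.distrib sum_distrib_left
                add_divide_distrib distrib_left)
        qed
        finally show ?case .
      qed
    qed
    from tendsto_add[OF this S] show ?case by (simp add: F_def)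
  qed
qed

end
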